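(* Let $(M,g)$ be a complete non-flat three-dimensional $\kappa$-noncollapsed steady gradient Ricci soliton with $\mathrm{Ric}=D^2f$, and let $X=\nabla f$. Suppose that $W$ is a smooth vector field on $M$ satisfying $\Delta W+D_XW=0$. Then the Lie derivative $\mathscr{L}_W(g)$ satisfies \[\Delta_L(\mathscr{L}_W(g))+\mathscr{L}_X(\mathscr{L}_W(g))=0.\]
   Context: Manifolds are smooth, connected and without boundary. $(M,g)$ is $\kappa$-noncollapsed if, for some fixed $\kappa>0$, every metric ball $B$ of radius $\rho>0$ with $|\mathrm{Rm}|\leq\rho^{-2}$ on $B$ satisfies $\mathrm{vol}(B)\geq\kappa\rho^3$. $D$ is the Levi-Civita connection and $\Delta$ the rough Laplacian. $\Delta_L$ is the Lichnerowicz Laplacian on symmetric $(0,2)$-tensors, \[\Delta_Lh_{ik}=\Delta h_{ik}+2R_{ijkl}h^{jl}-\mathrm{Ric}_i^l h_{kl}-\mathrm{Ric}_k^l h_{il},\] with the curvature convention $\mathrm{Ric}_{ik}=g^{jl}R_{ijkl}$. *)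

theory Defs
  imports "HOL-Analysis.Analysis"
begin

section \<open>Smooth maps between normed spaces\<close>

text \<open>Meant for open \<open>S\<close>: at a point of \<open>S\<close> all derivatives are full derivatives.\<close>

primrec Ck_on :: "nat \<Rightarrow> 'a::real_normed_vector set \<Rightarrow> ('a \<Rightarrow> 'b::real_normed_vector) \<Rightarrow> bool" where
  "Ck_on 0 S F \<longleftrightarrow> continuous_on S F"
| "Ck_on (Suc k) S F \<longleftrightarrow>
     (\<forall>x\<in>S. F differentiable (at x)) \<and> (\<forall>v. Ck_on k S (\<lambda>x. frechet_derivative F (at x) v))"

definition smooth_on :: "'a::real_normed_vector set \<Rightarrow> ('a \<Rightarrow> 'b::real_normed_vector) \<Rightarrow> bool" where
  "smooth_on S F \<longleftrightarrow> (\<forall>k. Ck_on k S F)"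


section \<open>Tensor calculus in one coordinate system\<close>

text \<open>
  Here \<open>G\<close> is the matrix of components of the metric, as a function of the coordinates.
  Index arguments come in the order of the indices in classical notation, for example
  \<open>christoffel G k i j\<close> is the symbol with upper index \<open>k\<close> and lower indices \<open>i j\<close>.
  Indices of covariant differentiation come first.
\<close>

definition pd :: "'n::finite \<Rightarrow> (real^'n \<Rightarrow> real) \<Rightarrow> real^'n \<Rightarrow> real" where
  "pd i F x = frechet_derivative F (at x) (axis i 1)"

definition christoffel ::
  "(real^'n \<Rightarrow> real^'n^'n) \<Rightarrow> 'n::finite \<Rightarrow> 'n \<Rightarrow> 'n \<Rightarrow> real^'n \<Rightarrow> real" where
  "christoffel G k i j x = (1/2) * (\<Sum>l\<in>UNIV. matrix_inv (G x) $ k $ l *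
     (pd i (\<lambda>y. G y $ j $ l) x + pd j (\<lambda>y. G y $ i $ l) x - pd l (\<lambda>y. G y $ i $ j) x))"

text \<open>
  \<open>riemann_up G i j k l\<close> is the \<open>l\<close>-th component of
  \<open>D\<^sub>i D\<^sub>j e\<^sub>k - D\<^sub>j D\<^sub>i e\<^sub>k\<close> for the coordinate frame \<open>e\<close>.
  The last two indices of \<open>riemann\<close> are ordered so that \<open>R\<^sub>i\<^sub>j\<^sub>i\<^sub>j\<close> is positive on round
  spheres, which makes \<open>Ric\<^sub>i\<^sub>k = g\<^sup>j\<^sup>l R\<^sub>i\<^sub>j\<^sub>k\<^sub>l\<close> the usual Ricci tensor.
\<close>

definition riemann_up ::
  "(real^'n \<Rightarrow> real^'n^'n) \<Rightarrow> 'n::finite \<Rightarrow> 'n \<Rightarrow> 'n \<Rightarrow> 'n \<Rightarrow> real^'n \<Rightarrow> real" where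
  "riemann_up G i j k l x =
     pd i (christoffel G l j k) x - pd j (christoffel G l i k) x
     + (\<Sum>m\<in>UNIV. christoffel G l i m x * christoffel G m j k x
                 - christoffel G l j m x * christoffel G m i k x)"

definition riemann ::
  "(real^'n \<Rightarrow> real^'n^'n) \<Rightarrow> 'n::finite \<Rightarrow> 'n \<Rightarrow> 'n \<Rightarrow> 'n \<Rightarrow> real^'n \<Rightarrow> real" where
  "riemann G i j k l x = (\<Sum>m\<in>UNIV. G x $ k $ m * riemann_up G i j l m x)"

definition ricci :: "(real^'n \<Rightarrow> real^'n^'n) \<Rightarrow> real^'n \<Rightarrow> real^('n::finite)^'n" where
  "ricci G x = (\<chi> i k. \<Sum>j\<in>UNIV. \<Sum>l\<in>UNIV. matrix_inv (G x) $ j $ l * riemann G i j k l x)"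

definition riemann_norm :: "(real^'n \<Rightarrow> real^'n^'n) \<Rightarrow> real^('n::finite) \<Rightarrow> real" where
  "riemann_norm G x = sqrt (\<Sum>i\<in>UNIV. \<Sum>j\<in>UNIV. \<Sum>k\<in>UNIV. \<Sum>l\<in>UNIV.
     \<Sum>i'\<in>UNIV. \<Sum>j'\<in>UNIV. \<Sum>k'\<in>UNIV. \<Sum>l'\<in>UNIV.
       matrix_inv (G x) $ i $ i' * matrix_inv (G x) $ j $ j' *
       matrix_inv (G x) $ k $ k' * matrix_inv (G x) $ l $ l' *
       riemann G i j k l x * riemann G i' j' k' l' x)"

definition hessian ::
  "(real^'n \<Rightarrow> real^'n^'n) \<Rightarrow> (real^'n \<Rightarrow> real) \<Rightarrow> real^'n \<Rightarrow> real^('n::finite)^'n" where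
  "hessian G F x = (\<chi> i j. pd i (pd j F) x - (\<Sum>k\<in>UNIV. christoffel G k i j x * pd k F x))"

definition gradient ::
  "(real^'n \<Rightarrow> real^'n^'n) \<Rightarrow> (real^'n \<Rightarrow> real) \<Rightarrow> real^'n \<Rightarrow> real^('n::finite)" where
  "gradient G F x = (\<chi> i. \<Sum>j\<in>UNIV. matrix_inv (G x) $ i $ j * pd j F x)"

definition cov_vec ::
  "(real^'n \<Rightarrow> real^'n^'n) \<Rightarrow> (real^'n \<Rightarrow> real^'n) \<Rightarrow> 'n::finite \<Rightarrow> 'n \<Rightarrow> real^'n \<Rightarrow> real" where
  "cov_vec G V j i x = pd j (\<lambda>y. V y $ i) x + (\<Sum>k\<in>UNIV. christoffel G i j k x * V x $ k)"

text \<open>\<open>cov2_vec G V j k i\<close> is the \<open>i\<close>-th component of the tensorial second derivative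
  \<open>D\<^sup>2 V\<close> evaluated at \<open>(e\<^sub>j, e\<^sub>k)\<close>; likewise \<open>cov2_ten\<close> below.\<close>

definition cov2_vec ::
  "(real^'n \<Rightarrow> real^'n^'n) \<Rightarrow> (real^'n \<Rightarrow> real^'n) \<Rightarrow> 'n::finite \<Rightarrow> 'n \<Rightarrow> 'n \<Rightarrow> real^'n \<Rightarrow> real" where
  "cov2_vec G V j k i x = pd j (cov_vec G V k i) x
     + (\<Sum>l\<in>UNIV. christoffel G i j l x * cov_vec G V k l x)
     - (\<Sum>l\<in>UNIV. christoffel G l j k x * cov_vec G V l i x)"

definition laplacian_vec ::
  "(real^'n \<Rightarrow> real^'n^'n) \<Rightarrow> (real^'n \<Rightarrow> real^'n) \<Rightarrow> real^'n \<Rightarrow> real^('n::finite)" where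
  "laplacian_vec G V x =
     (\<chi> i. \<Sum>j\<in>UNIV. \<Sum>k\<in>UNIV. matrix_inv (G x) $ j $ k * cov2_vec G V j k i x)"

definition cov_along ::
  "(real^'n \<Rightarrow> real^'n^'n) \<Rightarrow> (real^'n \<Rightarrow> real^'n) \<Rightarrow> (real^'n \<Rightarrow> real^'n) \<Rightarrow> real^'n \<Rightarrow> real^('n::finite)" where
  "cov_along G X V x = (\<chi> i. \<Sum>j\<in>UNIV. X x $ j * cov_vec G V j i x)"

definition cov_ten ::
  "(real^'n \<Rightarrow> real^'n^'n) \<Rightarrow> (real^'n \<Rightarrow> real^'n^'n) \<Rightarrow> 'n::finite \<Rightarrow> 'n \<Rightarrow> 'n \<Rightarrow> real^'n \<Rightarrow> real" where
  "cov_ten G H l i k x = pd l (\<lambda>y. H y $ i $ k) x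
     - (\<Sum>m\<in>UNIV. christoffel G m l i x * H x $ m $ k)
     - (\<Sum>m\<in>UNIV. christoffel G m l k x * H x $ i $ m)"

definition cov2_ten ::
  "(real^'n \<Rightarrow> real^'n^'n) \<Rightarrow> (real^'n \<Rightarrow> real^'n^'n) \<Rightarrow> 'n::finite \<Rightarrow> 'n \<Rightarrow> 'n \<Rightarrow> 'n \<Rightarrow> real^'n \<Rightarrow> real" where
  "cov2_ten G H m l i k x = pd m (cov_ten G H l i k) x
     - (\<Sum>p\<in>UNIV. christoffel G p m l x * cov_ten G H p i k x)
     - (\<Sum>p\<in>UNIV. christoffel G p m i x * cov_ten G H l p k x)
     - (\<Sum>p\<in>UNIV. christoffel G p m k x * cov_ten G H l i p x)"

definition laplacian_ten ::
  "(real^'n \<Rightarrow> real^'n^'n) \<Rightarrow> (real^'n \<Rightarrow> real^'n^'n) \<Rightarrow> real^'n \<Rightarrow> real^('n::finite)^'n" where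
  "laplacian_ten G H x =
     (\<chi> i k. \<Sum>m\<in>UNIV. \<Sum>l\<in>UNIV. matrix_inv (G x) $ m $ l * cov2_ten G H m l i k x)"

definition lichnerowicz ::
  "(real^'n \<Rightarrow> real^'n^'n) \<Rightarrow> (real^'n \<Rightarrow> real^'n^'n) \<Rightarrow> real^'n \<Rightarrow> real^('n::finite)^'n" where
  "lichnerowicz G H x = (\<chi> i k. laplacian_ten G H x $ i $ k
     + 2 * (\<Sum>j\<in>UNIV. \<Sum>l\<in>UNIV. riemann G i j k l x *
              (\<Sum>p\<in>UNIV. \<Sum>q\<in>UNIV. matrix_inv (G x) $ j $ p * matrix_inv (G x) $ l $ q * H x $ p $ q))
     - (\<Sum>l\<in>UNIV. (\<Sum>m\<in>UNIV. matrix_inv (G x) $ l $ m * ricci G x $ i $ m) * H x $ k $ l)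
     - (\<Sum>l\<in>UNIV. (\<Sum>m\<in>UNIV. matrix_inv (G x) $ l $ m * ricci G x $ k $ m) * H x $ i $ l))"

definition lie_ten ::
  "(real^'n \<Rightarrow> real^'n) \<Rightarrow> (real^'n \<Rightarrow> real^'n^'n) \<Rightarrow> real^'n \<Rightarrow> real^('n::finite)^'n" where
  "lie_ten V H x = (\<chi> i j. \<Sum>k\<in>UNIV. V x $ k * pd k (\<lambda>y. H y $ i $ j) x
     + H x $ k $ j * pd i (\<lambda>y. V y $ k) x + H x $ i $ k * pd j (\<lambda>y. V y $ k) x)"


section \<open>Smooth manifolds and tensor fields\<close>

text \<open>
  A manifold is a whole Hausdorff, second countable type together with a smooth atlas. A chart is
  its domain together with a map into coordinate space, irrelevant outside the domain.
\<close>

type_synonym ('a, 'n) chart = "'a set \<times> ('a \<Rightarrow> real^'n)"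

definition coords :: "('a, 'n::finite) chart \<Rightarrow> (real^'n) set" where
  "coords c = snd c ` fst c"

definition chart_inv :: "('a, 'n::finite) chart \<Rightarrow> real^'n \<Rightarrow> 'a" where
  "chart_inv c = inv_into (fst c) (snd c)"

definition transition :: "('a, 'n::finite) chart \<Rightarrow> ('a, 'n) chart \<Rightarrow> real^'n \<Rightarrow> real^'n" where
  "transition c d = snd d \<circ> chart_inv c"

definition overlap :: "('a, 'n::finite) chart \<Rightarrow> ('a, 'n) chart \<Rightarrow> (real^'n) set" where
  "overlap c d = snd c ` (fst c \<inter> fst d)"

definition connected_smooth_manifold ::
  "('a::{t2_space,second_countable_topology}, 'n::finite) chart set \<Rightarrow> bool" where
  "connected_smooth_manifold A \<longleftrightarrow>
     connected (UNIV :: 'a set) \<and> (\<Union>c\<in>A. fst c) = UNIV \<and>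
     (\<forall>c\<in>A. open (fst c) \<and> open (coords c) \<and>
              homeomorphism (fst c) (coords c) (snd c) (chart_inv c)) \<and>
     (\<forall>c\<in>A. \<forall>d\<in>A. smooth_on (overlap c d) (transition c d))"

text \<open>
  A tensor field is the family of its components in the charts of the atlas, as functions of the
  coordinates, subject to the classical transformation law.
\<close>

type_synonym ('a, 'n) vfield = "('a, 'n) chart \<Rightarrow> real^'n \<Rightarrow> real^'n"
type_synonym ('a, 'n) tfield = "('a, 'n) chart \<Rightarrow> real^'n \<Rightarrow> real^'n^'n"

definition in_chart :: "('a \<Rightarrow> real) \<Rightarrow> ('a, 'n::finite) chart \<Rightarrow> real^'n \<Rightarrow> real" where
  "in_chart f c = f \<circ> chart_inv c"

definition smooth_function :: "('a, 'n::finite) chart set \<Rightarrow> ('a \<Rightarrow> real) \<Rightarrow> bool" where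
  "smooth_function A f \<longleftrightarrow> (\<forall>c\<in>A. smooth_on (coords c) (in_chart f c))"

definition smooth_vector_field :: "('a, 'n::finite) chart set \<Rightarrow> ('a, 'n) vfield \<Rightarrow> bool" where
  "smooth_vector_field A V \<longleftrightarrow>
     (\<forall>c\<in>A. smooth_on (coords c) (V c)) \<and>
     (\<forall>c\<in>A. \<forall>d\<in>A. \<forall>x\<in>overlap c d.
        V d (transition c d x) = jacobian (transition c d) (at x) *v V c x)"

definition smooth_cov2_tensor :: "('a, 'n::finite) chart set \<Rightarrow> ('a, 'n) tfield \<Rightarrow> bool" where
  "smooth_cov2_tensor A H \<longleftrightarrow>
     (\<forall>c\<in>A. smooth_on (coords c) (H c)) \<and>
     (\<forall>c\<in>A. \<forall>d\<in>A. \<forall>x\<in>overlap c d.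
        H c x = transpose (jacobian (transition c d) (at x)) ** H d (transition c d x)
                  ** jacobian (transition c d) (at x))"

definition riemannian_metric :: "('a, 'n::finite) chart set \<Rightarrow> ('a, 'n) tfield \<Rightarrow> bool" where
  "riemannian_metric A g \<longleftrightarrow> smooth_cov2_tensor A g \<and>
     (\<forall>c\<in>A. \<forall>x\<in>coords c. transpose (g c x) = g c x \<and> (\<forall>v. v \<noteq> 0 \<longrightarrow> v \<bullet> (g c x *v v) > 0))"

definition grad_field :: "('a, 'n::finite) tfield \<Rightarrow> ('a \<Rightarrow> real) \<Rightarrow> ('a, 'n) vfield" where
  "grad_field g f c = gradient (g c) (in_chart f c)"

definition lie_field :: "('a, 'n::finite) vfield \<Rightarrow> ('a, 'n) tfield \<Rightarrow> ('a, 'n) tfield" where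
  "lie_field V H c = lie_ten (V c) (H c)"

definition flat :: "('a, 'n::finite) chart set \<Rightarrow> ('a, 'n) tfield \<Rightarrow> bool" where
  "flat A g \<longleftrightarrow> (\<forall>c\<in>A. \<forall>x\<in>coords c. \<forall>i j k l. riemann (g c) i j k l x = 0)"

definition steady_gradient_soliton ::
  "('a, 'n::finite) chart set \<Rightarrow> ('a, 'n) tfield \<Rightarrow> ('a \<Rightarrow> real) \<Rightarrow> bool" where
  "steady_gradient_soliton A g f \<longleftrightarrow> smooth_function A f \<and>
     (\<forall>c\<in>A. \<forall>x\<in>coords c. ricci (g c) x = hessian (g c) (in_chart f c) x)"


section \<open>Distance, completeness, volume\<close>

text \<open>Pointwise scalars (speed of a curve, norm of the curvature) do not depend on the chart in
  which they are computed; an arbitrary chart around the point is selected.\<close>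

definition chart_at :: "('a, 'n::finite) chart set \<Rightarrow> 'a \<Rightarrow> ('a, 'n) chart" where
  "chart_at A p = (SOME c. c \<in> A \<and> p \<in> fst c)"

definition curvature_norm :: "('a, 'n::finite) chart set \<Rightarrow> ('a, 'n) tfield \<Rightarrow> 'a \<Rightarrow> real" where
  "curvature_norm A g p = (let c = chart_at A p in riemann_norm (g c) (snd c p))"

definition pw_C1_curve ::
  "('a::topological_space, 'n::finite) chart set \<Rightarrow> (real \<Rightarrow> 'a) \<Rightarrow> bool" where
  "pw_C1_curve A \<gamma> \<longleftrightarrow> continuous_on {0..1} \<gamma> \<and>
     (\<exists>S. finite S \<and> (\<forall>c\<in>A. (snd c \<circ> \<gamma>) C1_differentiable_on {t\<in>{0<..<1} - S. \<gamma> t \<in> fst c}))"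

definition speed ::
  "('a, 'n::finite) chart set \<Rightarrow> ('a, 'n) tfield \<Rightarrow> (real \<Rightarrow> 'a) \<Rightarrow> real \<Rightarrow> real" where
  "speed A g \<gamma> t = (let c = chart_at A (\<gamma> t); v = vector_derivative (snd c \<circ> \<gamma>) (at t)
     in sqrt (v \<bullet> (g c (snd c (\<gamma> t)) *v v)))"

text \<open>The derivative of a curve may blow up at the finitely many exceptional times, hence the
  length is an integral in \<open>[0, \<infinity>]\<close>; such curves do not affect the infimum.\<close>

definition curve_length ::
  "('a, 'n::finite) chart set \<Rightarrow> ('a, 'n) tfield \<Rightarrow> (real \<Rightarrow> 'a) \<Rightarrow> ennreal" where
  "curve_length A g \<gamma> = (\<integral>\<^sup>+t\<in>{0..1}. ennreal (speed A g \<gamma> t) \<partial>lborel)"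

definition riem_dist ::
  "('a::topological_space, 'n::finite) chart set \<Rightarrow> ('a, 'n) tfield \<Rightarrow> 'a \<Rightarrow> 'a \<Rightarrow> real" where
  "riem_dist A g p q =
     enn2real (INF \<gamma>\<in>{\<gamma>. pw_C1_curve A \<gamma> \<and> \<gamma> 0 = p \<and> \<gamma> 1 = q}. curve_length A g \<gamma>)"

definition riem_complete ::
  "('a::topological_space, 'n::finite) chart set \<Rightarrow> ('a, 'n) tfield \<Rightarrow> bool" where
  "riem_complete A g \<longleftrightarrow> Metric_space.mcomplete UNIV (riem_dist A g)"

definition riem_ball ::
  "('a::topological_space, 'n::finite) chart set \<Rightarrow> ('a, 'n) tfield \<Rightarrow> 'a \<Rightarrow> real \<Rightarrow> 'a set" where
  "riem_ball A g p \<rho> = Metric_space.mball UNIV (riem_dist A g) p \<rho>"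

text \<open>The unique Borel measure that is \<open>sqrt (det g) dx\<close> in every chart.\<close>

definition riem_volume ::
  "('a::topological_space, 'n::finite) chart set \<Rightarrow> ('a, 'n) tfield \<Rightarrow> 'a measure" where
  "riem_volume A g = (THE \<mu>. sets \<mu> = sets borel \<and>
     (\<forall>c\<in>A. \<forall>B\<in>sets borel. B \<subseteq> fst c \<longrightarrow>
        emeasure \<mu> B = (\<integral>\<^sup>+x\<in>snd c ` B. ennreal (sqrt (det (g c x))) \<partial>lborel)))"

definition noncollapsed ::
  "real \<Rightarrow> ('a::topological_space, 3) chart set \<Rightarrow> ('a, 3) tfield \<Rightarrow> bool" where
  "noncollapsed \<kappa> A g \<longleftrightarrow> \<kappa> > 0 \<and>
     (\<forall>p \<rho>. \<rho> > 0 \<and> (\<forall>q\<in>riem_ball A g p \<rho>. curvature_norm A g q \<le> 1 / \<rho>\<^sup>2) \<longrightarrow>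
        emeasure (riem_volume A g) (riem_ball A g p \<rho>) \<ge> ennreal (\<kappa> * \<rho> ^ 3))"

end

theory Submission
  imports Defs
begin

text \<open>
  The identity is local, so it is proved in one chart. Let \<open>w\<close> be the covector field obtained from \<open>W\<close>
  by lowering the index, and \<open>B\<^sub>i\<^sub>k = D\<^sub>i w\<^sub>k\<close>; then \<open>\<L>\<^sub>W g = B + B\<^sup>T\<close>. It turns out that \<open>B\<close> itself
  satisfies
    \<open>\<Delta>B\<^sub>i\<^sub>k + D\<^sub>X B\<^sub>i\<^sub>k + 2 R\<^sub>i\<^sub>j\<^sub>k\<^sub>l B\<^sup>j\<^sup>l = 0\<close> (lemma \<open>soliton_laplacian\<close>),
  and this equation is invariant under transposition by the pair symmetry of the curvature. In
  \<open>\<Delta>\<^sub>L + \<L>\<^sub>X\<close> the two Ricci terms of \<open>\<Delta>\<^sub>L\<close> cancel the terms \<open>h(D X, \<cdot>) + h(\<cdot>, D X)\<close> by which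
  \<open>\<L>\<^sub>X h\<close> differs from \<open>D\<^sub>X h\<close>, because \<open>D X = D\<^sup>2 f = Ric\<close>; so the symmetrised equation is the claim.

  For the equation of \<open>B\<close>, the Ricci identities move the Laplacian past the derivative
  (lemma \<open>laplacian_commutation\<close>):
    \<open>\<Delta>B\<^sub>i\<^sub>k = D\<^sub>i \<Delta>w\<^sub>k + Ric\<^sub>i\<^sup>p B\<^sub>p\<^sub>k - 2 R\<^sub>i\<^sub>j\<^sub>k\<^sub>l B\<^sup>j\<^sup>l + (D\<^sub>k Ric\<^sub>q\<^sub>i - D\<^sub>q Ric\<^sub>k\<^sub>i) W\<^sup>q\<close>,
  where the last term is a divergence of curvature evaluated with the second Bianchi identity.
  The hypothesis on \<open>W\<close> gives
    \<open>D\<^sub>i \<Delta>w\<^sub>k = - D\<^sub>i (X\<^sup>q B\<^sub>q\<^sub>k) = - Ric\<^sub>i\<^sup>q B\<^sub>q\<^sub>k - X\<^sup>q D\<^sub>i B\<^sub>q\<^sub>k\<close>,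
  so the Ricci terms cancel. Exchanging the derivatives in \<open>D\<^sub>i B\<^sub>q\<^sub>k = D\<^sub>i D\<^sub>q w\<^sub>k\<close> produces
  \<open>- D\<^sub>X B\<^sub>i\<^sub>k\<close> and a curvature term in \<open>X\<close> and \<open>W\<close>. Since \<open>Ric = D\<^sup>2 f\<close>, the difference
  \<open>D\<^sub>k Ric\<^sub>q\<^sub>i - D\<^sub>q Ric\<^sub>k\<^sub>i\<close> is a commutator of derivatives of \<open>df\<close>, hence also a curvature term in \<open>X\<close>;
  the two cancel.

  What this needs is the tensor calculus of a metric in coordinates: symmetry of second partial
  derivatives, product rules for contractions, parallelism of the metric, the Ricci identities
  for tensors of rank one and two, and the symmetries and Bianchi identities of the curvature.
\<close>

section \<open>Smooth functions on open sets\<close>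

lemma frechet_derivative_eqI:
  "(F has_derivative F') (at x) \<Longrightarrow> frechet_derivative F (at x) v = F' v"
  by (metis frechet_derivative_at)

text \<open>Derivatives at a point of an open set see only the values on that set. This lets every later
  closure property be checked with a formula for the derivative that is valid on \<open>S\<close> alone.\<close>

lemma Ck_on_cong:
  assumes "open S" "\<And>x. x \<in> S \<Longrightarrow> F x = H x"
  shows "Ck_on k S F \<longleftrightarrow> Ck_on k S H"
  using assms(2)
proof (induction k arbitrary: F H)
  case 0
  then show ?case by (auto cong: continuous_on_cong)
next
  case (Suc k)
  have one: "H differentiable (at x) \<and> frechet_derivative F (at x) = frechet_derivative H (at x)"
    if "x \<in> S" "F differentiable (at x)" "\<And>x. x \<in> S \<Longrightarrow> F x = H x" for x F H
  proof -
    have "(F has_derivative frechet_derivative F (at x)) (at x)"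
      using that(2) by (simp add: frechet_derivative_works)
    then have "(H has_derivative frechet_derivative F (at x)) (at x)"
      by (rule has_derivative_transform_within_open[OF _ assms(1) that(1) that(3)])
    then show ?thesis using frechet_derivative_at[of H] by (auto simp: differentiable_def)
  qed
  have "(\<forall>x\<in>S. F differentiable (at x)) \<longleftrightarrow> (\<forall>x\<in>S. H differentiable (at x))"
    using one[of _ F H] one[of _ H F] Suc.prems by metis
  moreover have "Ck_on k S (\<lambda>x. frechet_derivative F (at x) v) \<longleftrightarrow>
      Ck_on k S (\<lambda>x. frechet_derivative H (at x) v)" if "\<forall>x\<in>S. F differentiable (at x)" for v
    by (rule Suc.IH) (use one[of _ F H] that Suc.prems in metis)
  ultimately show ?case by auto
qed

text \<open>The introduction rule behind the closure properties: a candidate derivative, known only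
  on \<open>S\<close>, may replace the chosen one of the definition.\<close>

lemma Ck_on_SucI:
  assumes "open S" "\<And>x. x \<in> S \<Longrightarrow> (F has_derivative F' x) (at x)"
    and "\<And>v. Ck_on k S (\<lambda>x. F' x v)"
  shows "Ck_on (Suc k) S F"
proof -
  have "Ck_on k S (\<lambda>x. frechet_derivative F (at x) v)" for v
    using assms(3)[of v] Ck_on_cong[OF assms(1), of "\<lambda>x. frechet_derivative F (at x) v" "\<lambda>x. F' x v"]
      frechet_derivative_eqI[OF assms(2)] by blast
  then show ?thesis using assms(2) by (auto simp: differentiable_def)
qed

lemma Ck_on_SucD:
  "Ck_on (Suc k) S F \<Longrightarrow> x \<in> S \<Longrightarrow> (F has_derivative frechet_derivative F (at x)) (at x)"
  "Ck_on (Suc k) S F \<Longrightarrow> Ck_on k S (\<lambda>x. frechet_derivative F (at x) v)"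
  using frechet_derivative_works by auto

lemma Ck_on_Suc_imp: "Ck_on (Suc k) S F \<Longrightarrow> Ck_on k S F"
proof (induction k arbitrary: F)
  case 0
  then show ?case
    by (auto intro!: continuous_at_imp_continuous_on differentiable_imp_continuous_within)
next
  case (Suc k)
  then show ?case by simp
qed

lemma Ck_on_const: "Ck_on k S (\<lambda>x. c)"
  by (induction k arbitrary: c) auto

lemma Ck_on_add:
  assumes "open S"
  shows "Ck_on k S F \<Longrightarrow> Ck_on k S H \<Longrightarrow> Ck_on k S (\<lambda>x. F x + H x)"
proof (induction k arbitrary: F H)
  case 0
  then show ?case by (auto intro: continuous_intros)
next
  case (Suc k)
  show ?case
    by (rule Ck_on_SucI[OF assms has_derivative_add[OF Ck_on_SucD(1)[OF Suc.prems(1)] Ck_on_SucD(1)[OF Suc.prems(2)]]])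
      (use Suc.IH Ck_on_SucD(2)[OF Suc.prems(1)] Ck_on_SucD(2)[OF Suc.prems(2)] in auto)
qed

lemma Ck_on_mult:
  fixes F H :: "'a::real_normed_vector \<Rightarrow> real"
  assumes "open S"
  shows "Ck_on k S F \<Longrightarrow> Ck_on k S H \<Longrightarrow> Ck_on k S (\<lambda>x. F x * H x)"
proof (induction k arbitrary: F H)
  case 0
  then show ?case by (auto intro: continuous_intros)
next
  case (Suc k)
  note F = Suc.prems(1) and H = Suc.prems(2)
  show ?case
    by (rule Ck_on_SucI[OF assms has_derivative_mult[OF Ck_on_SucD(1)[OF F] Ck_on_SucD(1)[OF H]]])
      (use Suc.IH Ck_on_SucD(2)[OF F] Ck_on_SucD(2)[OF H] Ck_on_Suc_imp[OF F] Ck_on_Suc_imp[OF H]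
        in \<open>auto intro!: Ck_on_add[OF assms]\<close>)
qed

lemma Ck_on_inverse:
  fixes F :: "'a::real_normed_vector \<Rightarrow> real"
  assumes "open S" and nz: "\<And>x. x \<in> S \<Longrightarrow> F x \<noteq> 0"
  shows "Ck_on k S F \<Longrightarrow> Ck_on k S (\<lambda>x. inverse (F x))"
proof (induction k)
  case 0
  then show ?case using nz by (auto intro: continuous_intros)
next
  case (Suc k)
  note F = Suc.prems
  have inv: "Ck_on k S (\<lambda>x. inverse (F x))" using Suc.IH Ck_on_Suc_imp[OF F] by blast
  have "Ck_on k S (\<lambda>x. - 1 * (inverse (F x) * frechet_derivative F (at x) v * inverse (F x)))" for v
    by (intro Ck_on_mult[OF assms(1)] inv Ck_on_SucD(2)[OF F] Ck_on_const)
  then show ?case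
    by (intro Ck_on_SucI[OF assms(1) Deriv.has_derivative_inverse[OF nz Ck_on_SucD(1)[OF F]]]) auto
qed

lemma Ck_on_bounded_linear:
  assumes "open S" "bounded_linear L"
  shows "Ck_on k S F \<Longrightarrow> Ck_on k S (\<lambda>x. L (F x))"
proof (induction k arbitrary: F)
  case 0
  then show ?case
    using assms(2) by (auto intro: bounded_linear.continuous_on)
next
  case (Suc k)
  note F = Suc.prems
  show ?case
    by (rule Ck_on_SucI[OF assms(1) bounded_linear.has_derivative[OF assms(2) Ck_on_SucD(1)[OF F]]])
      (use Suc.IH Ck_on_SucD(2)[OF F] in auto)
qed

lemma smooth_on_const: "smooth_on S (\<lambda>x. c)"
  by (simp add: smooth_on_def Ck_on_const)

context
  fixes S :: "'a::real_normed_vector set"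
  assumes S: "open S"
begin

lemma smooth_on_cong: "(\<And>x. x \<in> S \<Longrightarrow> F x = H x) \<Longrightarrow> smooth_on S F \<longleftrightarrow> smooth_on S H"
  unfolding smooth_on_def using Ck_on_cong[OF S] by metis

lemma smooth_on_add: "smooth_on S F \<Longrightarrow> smooth_on S H \<Longrightarrow> smooth_on S (\<lambda>x. F x + H x)"
  by (simp add: smooth_on_def Ck_on_add[OF S])

lemma smooth_on_bounded_linear:
  "bounded_linear L \<Longrightarrow> smooth_on S F \<Longrightarrow> smooth_on S (\<lambda>x. L (F x))"
  by (simp add: smooth_on_def Ck_on_bounded_linear[OF S])

lemma smooth_on_minus: "smooth_on S F \<Longrightarrow> smooth_on S (\<lambda>x. - F x)"
  by (rule smooth_on_bounded_linear[OF bounded_linear_minus[OF bounded_linear_ident]])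

lemma smooth_on_diff: "smooth_on S F \<Longrightarrow> smooth_on S H \<Longrightarrow> smooth_on S (\<lambda>x. F x - H x)"
  using smooth_on_add[of F "\<lambda>x. - H x"] smooth_on_minus[of H] by simp

lemma smooth_on_sum:
  "(\<And>i. i \<in> I \<Longrightarrow> smooth_on S (F i)) \<Longrightarrow> smooth_on S (\<lambda>x. \<Sum>i\<in>I. F i x)"
  by (induction I rule: infinite_finite_induct) (auto intro: smooth_on_add smooth_on_const)

lemma smooth_on_mult:
  fixes F H :: "'a \<Rightarrow> real"
  shows "smooth_on S F \<Longrightarrow> smooth_on S H \<Longrightarrow> smooth_on S (\<lambda>x. F x * H x)"
  by (simp add: smooth_on_def Ck_on_mult[OF S])

lemma smooth_on_prod:
  fixes F :: "'i \<Rightarrow> 'a \<Rightarrow> real"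
  shows "(\<And>i. i \<in> I \<Longrightarrow> smooth_on S (F i)) \<Longrightarrow> smooth_on S (\<lambda>x. \<Prod>i\<in>I. F i x)"
  by (induction I rule: infinite_finite_induct) (auto intro: smooth_on_mult smooth_on_const)

lemma smooth_on_inverse:
  fixes F :: "'a \<Rightarrow> real"
  shows "smooth_on S F \<Longrightarrow> (\<And>x. x \<in> S \<Longrightarrow> F x \<noteq> 0) \<Longrightarrow> smooth_on S (\<lambda>x. inverse (F x))"
  by (simp add: smooth_on_def Ck_on_inverse[OF S])

lemma smooth_on_nth:
  "smooth_on S F \<Longrightarrow> smooth_on S (\<lambda>x. F x $ i)"
  by (rule smooth_on_bounded_linear[OF bounded_linear_vec_nth])

lemma smooth_on_det:
  fixes M :: "'a \<Rightarrow> real^'n^'n"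
  assumes "\<And>i j. smooth_on S (\<lambda>x. M x $ i $ j)"
  shows "smooth_on S (\<lambda>x. det (M x))"
  unfolding det_def by (intro smooth_on_sum smooth_on_mult smooth_on_prod smooth_on_const assms)

text \<open>Cramer's rule writes the entries of the inverse matrix as quotients of determinants.\<close>

lemma smooth_on_matrix_inv:
  fixes M :: "'a \<Rightarrow> real^'n^'n"
  assumes M: "\<And>i j. smooth_on S (\<lambda>x. M x $ i $ j)" and inv: "\<And>x. x \<in> S \<Longrightarrow> invertible (M x)"
  shows "smooth_on S (\<lambda>x. matrix_inv (M x) $ i $ j)"
proof -
  let ?C = "\<lambda>x. (\<chi> a b. if b = i then axis j 1 $ a else M x $ a $ b) :: real^'n^'n"
  have eq: "matrix_inv (M x) $ i $ j = det (?C x) * inverse (det (M x))" if "x \<in> S" for x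
  proof -
    have d: "det (M x) \<noteq> 0" using inv[OF that] by (simp add: invertible_det_nz)
    have "M x ** matrix_inv (M x) = mat 1"
      using inv[OF that] unfolding invertible_def matrix_inv_def by (metis (mono_tags, lifting) someI_ex)
    then have "M x *v (matrix_inv (M x) *v axis j 1) = axis j 1"
      by (simp add: matrix_vector_mul_assoc)
    then have "matrix_inv (M x) *v axis j 1 =
        (\<chi> k. det (\<chi> a b. if b = k then axis j 1 $ a else M x $ a $ b) / det (M x))"
      using cramer[OF d] by blast
    then have "(matrix_inv (M x) *v axis j 1) $ i = det (?C x) / det (M x)"
      by simp
    then show ?thesis
      by (simp add: matrix_vector_mul_component inner_axis divide_inverse)
  qed
  have "smooth_on S (\<lambda>x. det (?C x) * inverse (det (M x)))"
  proof (intro smooth_on_mult smooth_on_inverse smooth_on_det M)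
    show "smooth_on S (\<lambda>x. ?C x $ a $ b)" for a b
      using M by (cases "b = i") (auto intro: smooth_on_const)
    show "det (M x) \<noteq> 0" if "x \<in> S" for x using inv[OF that] by (simp add: invertible_det_nz)
  qed
  moreover have "smooth_on S (\<lambda>x. matrix_inv (M x) $ i $ j) \<longleftrightarrow>
      smooth_on S (\<lambda>x. det (?C x) * inverse (det (M x)))"
    by (rule smooth_on_cong) (rule eq)
  ultimately show ?thesis by blast
qed

end

lemma smooth_on_imp_differentiable: "smooth_on S F \<Longrightarrow> x \<in> S \<Longrightarrow> F differentiable (at x)"
  unfolding smooth_on_def by (metis Ck_on.simps(2))

lemma smooth_on_imp_continuous_on: "smooth_on S F \<Longrightarrow> continuous_on S F"
  unfolding smooth_on_def by (metis Ck_on.simps(1))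

section \<open>Partial derivatives\<close>

lemma smooth_on_pd: "smooth_on S F \<Longrightarrow> smooth_on S (pd i F)"
proof -
  assume "smooth_on S F"
  then have "Ck_on (Suc k) S F" for k by (simp only: smooth_on_def)
  then show ?thesis by (simp add: smooth_on_def pd_def[abs_def])
qed

lemma pd_eqI: "(F has_derivative F') (at x) \<Longrightarrow> pd i F x = F' (axis i 1)"
  unfolding pd_def by (rule frechet_derivative_eqI)

lemma pd_const: "pd i (\<lambda>x. c) x = 0"
  by (simp add: pd_def)

lemma pd_cong:
  assumes "open S" "x \<in> S" "smooth_on S F" "\<And>y. y \<in> S \<Longrightarrow> F y = H y"
  shows "pd i F x = pd i H x"
  using frechet_derivative_transform_within_open[OF smooth_on_imp_differentiable[OF assms(3,2)] assms(1,2,4)]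
  by (simp add: pd_def)

context
  fixes S :: "(real^'n) set" and x :: "real^'n" and F H :: "real^'n \<Rightarrow> real"
  assumes x: "x \<in> S" and F: "smooth_on S F" and H: "smooth_on S H"
begin

lemma
  shows pd_add: "pd i (\<lambda>y. F y + H y) x = pd i F x + pd i H x"
    and pd_diff: "pd i (\<lambda>y. F y - H y) x = pd i F x - pd i H x"
    and pd_mult: "pd i (\<lambda>y. F y * H y) x = pd i F x * H x + F x * pd i H x"
proof -
  note D = smooth_on_imp_differentiable[OF F x, unfolded frechet_derivative_works]
    smooth_on_imp_differentiable[OF H x, unfolded frechet_derivative_works]
  show "pd i (\<lambda>y. F y + H y) x = pd i F x + pd i H x"
    by (subst pd_eqI[OF has_derivative_add[OF D]]) (simp add: pd_def)
  show "pd i (\<lambda>y. F y - H y) x = pd i F x - pd i H x"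
    by (subst pd_eqI[OF has_derivative_diff[OF D]]) (simp add: pd_def)
  show "pd i (\<lambda>y. F y * H y) x = pd i F x * H x + F x * pd i H x"
    by (subst pd_eqI[OF has_derivative_mult[OF D]]) (simp add: pd_def)
qed

end

lemma pd_sum:
  assumes "x \<in> S" "\<And>k. k \<in> I \<Longrightarrow> smooth_on S (F k)"
  shows "pd i (\<lambda>y. \<Sum>k\<in>I. F k y) x = (\<Sum>k\<in>I. pd i (F k) x)"
proof -
  have "((\<lambda>y. \<Sum>k\<in>I. F k y) has_derivative (\<lambda>v. \<Sum>k\<in>I. frechet_derivative (F k) (at x) v)) (at x)"
    by (rule has_derivative_sum)
      (use assms smooth_on_imp_differentiable in \<open>auto simp: frechet_derivative_works[symmetric]\<close>)
  then show ?thesis by (subst pd_eqI) (auto simp: pd_def)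
qed

lemma DERIV_along_axis:
  assumes "F differentiable (at (p + s *\<^sub>R axis i 1))"
  shows "((\<lambda>s. F (p + s *\<^sub>R axis i 1)) has_real_derivative pd i F (p + s *\<^sub>R axis i 1)) (at s)"
proof -
  have F: "(F has_derivative frechet_derivative F (at (p + s *\<^sub>R axis i 1))) (at (p + s *\<^sub>R axis i 1))"
    using assms by (simp add: frechet_derivative_works)
  have "((\<lambda>s. F (p + s *\<^sub>R axis i 1)) has_derivative
      (\<lambda>t. frechet_derivative F (at (p + s *\<^sub>R axis i 1)) (t *\<^sub>R axis i 1))) (at s)"
    by (rule has_derivative_compose[where f = "\<lambda>s. p + s *\<^sub>R axis i 1", OF _ F])
      (auto intro!: derivative_eq_intros)
  moreover have "frechet_derivative F (at (p + s *\<^sub>R axis i 1)) (t *\<^sub>R axis i 1)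
      = pd i F (p + s *\<^sub>R axis i 1) * t" for t
    using linear_scale[OF bounded_linear.linear[OF has_derivative_bounded_linear[OF F]], of t "axis i 1"]
    by (simp add: pd_def)
  ultimately show ?thesis by (simp add: has_field_derivative_def)
qed

text \<open>
  The mean value theorem is used twice: along \<open>i\<close> for the increment of \<open>F\<close> in direction \<open>j\<close>, then
  along \<open>j\<close> for \<open>pd i F\<close>. The left hand side is symmetric in \<open>i\<close> and \<open>j\<close>, so the two mixed
  derivatives agree at points arbitrarily close to \<open>x\<close>; continuity then gives
  \<open>pd_commute\<close>.
\<close>

lemma second_difference_eq:
  fixes F :: "real^'n \<Rightarrow> real"
  assumes S: "ball x r \<subseteq> S" and F: "smooth_on S F" and h: "0 < h" "2 * h < r"
  shows "\<exists>p\<in>ball x r. F (x + h *\<^sub>R axis i 1 + h *\<^sub>R axis j 1) - F (x + h *\<^sub>R axis i 1)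
    - F (x + h *\<^sub>R axis j 1) + F x = h * (h * pd j (pd i F) p)"
proof -
  have ball: "x + s *\<^sub>R axis i 1 + t *\<^sub>R axis j 1 \<in> ball x r" if "0 \<le> s" "s \<le> h" "0 \<le> t" "t \<le> h" for s t
  proof -
    have "norm (s *\<^sub>R axis i 1 + t *\<^sub>R axis j 1 :: real^'n) \<le> s + t"
      by (rule norm_triangle_le) (use that in simp)
    moreover have "dist x (x + (s *\<^sub>R axis i 1 + t *\<^sub>R axis j 1)) = norm (s *\<^sub>R axis i 1 + t *\<^sub>R axis j 1 :: real^'n)"
      by (metis add_diff_cancel_left' dist_commute dist_norm)
    ultimately show ?thesis using that h by (simp add: add.assoc)
  qed
  have diff: "F differentiable (at p)" "pd i F differentiable (at p)" if "p \<in> ball x r" for p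
    using smooth_on_imp_differentiable[OF F] smooth_on_imp_differentiable[OF smooth_on_pd[OF F]] that S
    by auto
  define u where "u = (\<lambda>s. F (x + h *\<^sub>R axis j 1 + s *\<^sub>R axis i 1) - F (x + s *\<^sub>R axis i 1))"
  have du: "(u has_real_derivative (pd i F (x + h *\<^sub>R axis j 1 + s *\<^sub>R axis i 1) - pd i F (x + s *\<^sub>R axis i 1))) (at s)"
    if "0 \<le> s" "s \<le> h" for s
    unfolding u_def
  proof (intro DERIV_diff DERIV_along_axis diff)
    show "x + h *\<^sub>R axis j 1 + s *\<^sub>R axis i 1 \<in> ball x r"
      using ball[of s h] that h by (simp only: add_ac order.refl less_imp_le)
    show "x + s *\<^sub>R axis i 1 \<in> ball x r"
      using ball[of s 0] that h by (simp only: scaleR_zero_left add_0_right order.refl less_imp_le)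
  qed
  then obtain s where s: "0 < s" "s < h"
    "u h - u 0 = (h - 0) * (pd i F (x + h *\<^sub>R axis j 1 + s *\<^sub>R axis i 1) - pd i F (x + s *\<^sub>R axis i 1))"
    using MVT2[OF h(1) du] by blast
  have dv: "((\<lambda>t. pd i F (x + s *\<^sub>R axis i 1 + t *\<^sub>R axis j 1)) has_real_derivative
      pd j (pd i F) (x + s *\<^sub>R axis i 1 + t *\<^sub>R axis j 1)) (at t)" if "0 \<le> t" "t \<le> h" for t
    by (intro DERIV_along_axis diff ball) (use that s in auto)
  then obtain t where t: "0 < t" "t < h"
    "pd i F (x + s *\<^sub>R axis i 1 + h *\<^sub>R axis j 1) - pd i F (x + s *\<^sub>R axis i 1 + 0 *\<^sub>R axis j 1)
      = (h - 0) * pd j (pd i F) (x + s *\<^sub>R axis i 1 + t *\<^sub>R axis j 1)"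
    using MVT2[OF h(1) dv] by blast
  show ?thesis
  proof (rule bexI)
    show "x + s *\<^sub>R axis i 1 + t *\<^sub>R axis j 1 \<in> ball x r" using ball s t by simp
    have "F (x + h *\<^sub>R axis i 1 + h *\<^sub>R axis j 1) - F (x + h *\<^sub>R axis i 1) - F (x + h *\<^sub>R axis j 1) + F x
        = u h - u 0"
      by (simp add: u_def algebra_simps)
    also have "\<dots> = h * (pd i F (x + s *\<^sub>R axis i 1 + h *\<^sub>R axis j 1) - pd i F (x + s *\<^sub>R axis i 1 + 0 *\<^sub>R axis j 1))"
      using s(3) by (simp add: algebra_simps)
    also have "\<dots> = h * (h * pd j (pd i F) (x + s *\<^sub>R axis i 1 + t *\<^sub>R axis j 1))"
      using t(3) by simp
    finally show "F (x + h *\<^sub>R axis i 1 + h *\<^sub>R axis j 1) - F (x + h *\<^sub>R axis i 1) - F (x + h *\<^sub>R axis j 1) + F x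
        = h * (h * pd j (pd i F) (x + s *\<^sub>R axis i 1 + t *\<^sub>R axis j 1))" .
  qed
qed

lemma pd_commute:
  fixes F :: "real^'n \<Rightarrow> real"
  assumes S: "open S" "x \<in> S" and F: "smooth_on S F"
  shows "pd i (pd j F) x = pd j (pd i F) x"
proof (rule ccontr)
  assume "pd i (pd j F) x \<noteq> pd j (pd i F) x"
  define e where "e = \<bar>pd i (pd j F) x - pd j (pd i F) x\<bar> / 2"
  have e: "e > 0" using \<open>_ \<noteq> _\<close> by (simp add: e_def)
  have cont: "isCont (pd a (pd b F)) x" for a b
    using smooth_on_imp_continuous_on[OF smooth_on_pd[OF smooth_on_pd[OF F]]] S
    by (simp add: continuous_on_eq_continuous_at)
  obtain r1 where r1: "r1 > 0" "\<And>p. p \<in> ball x r1 \<Longrightarrow> \<bar>pd i (pd j F) p - pd i (pd j F) x\<bar> < e"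
    using cont[of i j] e unfolding continuous_at_eps_delta by (auto simp: dist_commute dist_real_def)
  obtain r2 where r2: "r2 > 0" "\<And>p. p \<in> ball x r2 \<Longrightarrow> \<bar>pd j (pd i F) p - pd j (pd i F) x\<bar> < e"
    using cont[of j i] e unfolding continuous_at_eps_delta by (auto simp: dist_commute dist_real_def)
  obtain r3 where r3: "r3 > 0" "ball x r3 \<subseteq> S" using S open_contains_ball by blast
  define r where "r = min r1 (min r2 r3)"
  have r: "r > 0" "ball x r \<subseteq> S" "ball x r \<subseteq> ball x r1" "ball x r \<subseteq> ball x r2"
    using r1 r2 r3 by (auto simp: r_def)
  have h: "0 < r / 3" "2 * (r / 3) < r" using r by auto
  obtain p where p: "p \<in> ball x r" "F (x + (r/3) *\<^sub>R axis i 1 + (r/3) *\<^sub>R axis j 1) - F (x + (r/3) *\<^sub>R axis i 1)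
    - F (x + (r/3) *\<^sub>R axis j 1) + F x = (r/3) * ((r/3) * pd j (pd i F) p)"
    using second_difference_eq[OF r(2) F h] by blast
  obtain q where q: "q \<in> ball x r" "F (x + (r/3) *\<^sub>R axis j 1 + (r/3) *\<^sub>R axis i 1) - F (x + (r/3) *\<^sub>R axis j 1)
    - F (x + (r/3) *\<^sub>R axis i 1) + F x = (r/3) * ((r/3) * pd i (pd j F) q)"
    using second_difference_eq[OF r(2) F h] by blast
  have "(r/3) * ((r/3) * pd j (pd i F) p) = (r/3) * ((r/3) * pd i (pd j F) q)"
    using p(2) q(2) by (simp add: algebra_simps)
  then have "pd j (pd i F) p = pd i (pd j F) q" using r(1) by simp
  moreover have "\<bar>pd i (pd j F) q - pd i (pd j F) x\<bar> < e" "\<bar>pd j (pd i F) p - pd j (pd i F) x\<bar> < e"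
    using r1(2) r2(2) p(1) q(1) r(3,4) by blast+
  ultimately show False unfolding e_def by argo
qed

section \<open>Covariant derivatives in coordinates\<close>

text \<open>One coordinate patch: \<open>U\<close> is the coordinate domain and \<open>G\<close> the matrix of the metric.\<close>

locale local_metric =
  fixes U :: "(real^'n::finite) set" and G :: "real^'n \<Rightarrow> real^'n^'n"
  assumes open_U: "open U" and smooth_G: "smooth_on U G"
    and transpose_G: "x \<in> U \<Longrightarrow> transpose (G x) = G x"
    and positive_G: "x \<in> U \<Longrightarrow> v \<noteq> 0 \<Longrightarrow> v \<bullet> (G x *v v) > 0"
begin

abbreviation sm :: "(real^'n \<Rightarrow> real) \<Rightarrow> bool" where "sm \<equiv> smooth_on U"
abbreviation g :: "'n \<Rightarrow> 'n \<Rightarrow> real^'n \<Rightarrow> real" where "g i j \<equiv> \<lambda>x. G x $ i $ j"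
abbreviation gi :: "'n \<Rightarrow> 'n \<Rightarrow> real^'n \<Rightarrow> real" where "gi i j \<equiv> \<lambda>x. matrix_inv (G x) $ i $ j"
abbreviation \<Gamma> :: "'n \<Rightarrow> 'n \<Rightarrow> 'n \<Rightarrow> real^'n \<Rightarrow> real" where "\<Gamma> \<equiv> christoffel G"

lemma invertible_G: "x \<in> U \<Longrightarrow> invertible (G x)"
proof -
  assume x: "x \<in> U"
  have "v = 0" if "G x *v v = 0" for v
    using positive_G[OF x, of v] that by fastforce
  then show ?thesis
    using matrix_left_invertible_ker[of "G x"] invertible_left_inverse by blast
qed

lemma g_sym:
  assumes "x \<in> U"
  shows "g i j x = g j i x"
proof -
  have "g i j x = transpose (G x) $ j $ i" by (simp add: transpose_def)
  then show ?thesis by (simp add: transpose_G[OF assms])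
qed

lemma G_inverse:
  assumes "x \<in> U"
  shows "G x ** matrix_inv (G x) = mat 1" "matrix_inv (G x) ** G x = mat 1"
  using invertible_G[OF assms] unfolding invertible_def matrix_inv_def
  by (metis (mono_tags, lifting) someI_ex)+

lemma gi_sym:
  assumes "x \<in> U"
  shows "gi i j x = gi j i x"
proof -
  have "transpose (matrix_inv (G x)) ** G x = mat 1"
    using G_inverse(1)[OF assms] transpose_G[OF assms] by (metis matrix_transpose_mul transpose_mat)
  then have "transpose (matrix_inv (G x)) = matrix_inv (G x)"
    using G_inverse(1)[OF assms] by (metis matrix_mul_assoc matrix_mul_lid matrix_mul_rid)
  moreover have "gi i j x = transpose (matrix_inv (G x)) $ j $ i" by (simp add: transpose_def)
  ultimately show ?thesis by simp
qed

lemma sum_mat_1: "(\<Sum>q\<in>UNIV. (mat 1 :: real^'n^'n) $ i $ q * V q) = V i"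
  by (simp add: mat_def if_distrib[of "\<lambda>z. z * _"] cong: if_cong)

text \<open>The cancellations of \<open>g\<close> against its inverse go through this fact and the next one; stated with
  an arbitrary \<open>V\<close>, they keep Kronecker symbols out of longer sums.\<close>

lemma raise_lower:
  assumes "x \<in> U"
  shows "(\<Sum>p\<in>UNIV. gi i p x * (\<Sum>q\<in>UNIV. g p q x * V q)) = V i"
proof -
  have "(\<Sum>p\<in>UNIV. gi i p x * (\<Sum>q\<in>UNIV. g p q x * V q)) = (\<Sum>q\<in>UNIV. (matrix_inv (G x) ** G x) $ i $ q * V q)"
    unfolding matrix_matrix_mult_def
    by (simp add: sum_distrib_left sum_distrib_right mult.assoc) (rule sum.swap)
  then show ?thesis by (simp add: G_inverse[OF assms] sum_mat_1)
qed

lemma lower_raise: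
  assumes "x \<in> U"
  shows "(\<Sum>p\<in>UNIV. g i p x * (\<Sum>q\<in>UNIV. gi p q x * V q)) = V i"
proof -
  have "(\<Sum>p\<in>UNIV. g i p x * (\<Sum>q\<in>UNIV. gi p q x * V q)) = (\<Sum>q\<in>UNIV. (G x ** matrix_inv (G x)) $ i $ q * V q)"
    unfolding matrix_matrix_mult_def
    by (simp add: sum_distrib_left sum_distrib_right mult.assoc) (rule sum.swap)
  then show ?thesis by (simp add: G_inverse[OF assms] sum_mat_1)
qed

lemmas sm_intros = smooth_on_const smooth_on_add[OF open_U] smooth_on_diff[OF open_U] smooth_on_minus[OF open_U]
  smooth_on_mult[OF open_U] smooth_on_sum[OF open_U] smooth_on_pd

lemma sm_g: "sm (g i j)"
  by (intro smooth_on_nth[OF open_U] smooth_G)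

lemma sm_gi: "sm (gi i j)"
  by (rule smooth_on_matrix_inv[OF open_U sm_g invertible_G])

lemma sm_\<Gamma>: "sm (\<Gamma> k i j)"
  unfolding christoffel_def[abs_def] by (intro sm_intros sm_gi sm_g)

lemmas pd_rules = pd_add[where S=U] pd_diff[where S=U] pd_mult[where S=U] pd_sum[where S=U]

lemma pd_minus: "x \<in> U \<Longrightarrow> sm F \<Longrightarrow> pd l (\<lambda>y. - F y) x = - pd l F x"
  using pd_diff[of x U "\<lambda>y. 0" F l] by (simp add: sm_intros pd_const)

lemma pd_congU: "x \<in> U \<Longrightarrow> sm F \<Longrightarrow> (\<And>y. y \<in> U \<Longrightarrow> F y = H y) \<Longrightarrow> pd l F x = pd l H x"
  by (rule pd_cong[OF open_U])

lemma pd_g_sym: "x \<in> U \<Longrightarrow> pd l (g i j) x = pd l (g j i) x"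
  by (rule pd_congU[OF _ sm_g g_sym])

lemma \<Gamma>_sym: "x \<in> U \<Longrightarrow> \<Gamma> k i j x = \<Gamma> k j i x"
  by (simp add: christoffel_def pd_g_sym[of x _ i j] add.commute)

text \<open>
  Lowering the upper index of the Christoffel symbols gives their first kind; adding two of these
  shows that the metric is parallel.
\<close>

lemma lower_\<Gamma>:
  assumes "x \<in> U"
  shows "(\<Sum>k\<in>UNIV. g m k x * \<Gamma> k i j x) = (1/2) * (pd i (g j m) x + pd j (g i m) x - pd m (g i j) x)"
  using lower_raise[OF assms, of m "\<lambda>l. (1/2) * (pd i (g j l) x + pd j (g i l) x - pd l (g i j) x)"]
  by (simp add: christoffel_def sum_distrib_left mult.left_commute)

lemma pd_g:
  assumes x: "x \<in> U"
  shows "pd l (g i k) x = (\<Sum>m\<in>UNIV. \<Gamma> m l i x * g m k x) + (\<Sum>m\<in>UNIV. \<Gamma> m l k x * g i m x)"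
proof -
  have "(\<Sum>m\<in>UNIV. \<Gamma> m l i x * g m k x) = (\<Sum>m\<in>UNIV. g k m x * \<Gamma> m l i x)"
    by (simp add: mult.commute g_sym[OF x, of k])
  moreover have "(\<Sum>m\<in>UNIV. \<Gamma> m l k x * g i m x) = (\<Sum>m\<in>UNIV. g i m x * \<Gamma> m l k x)"
    by (simp add: mult.commute)
  ultimately show ?thesis
    by (simp add: lower_\<Gamma>[OF x] pd_g_sym[OF x, of _ k i] pd_g_sym[OF x, of _ k l] pd_g_sym[OF x, of _ l i])
qed

text \<open>Tensor fields are families of component functions. \<open>D1\<close> to \<open>D4\<close> are the covariant derivatives of
  tensors with that many lower slots; \<open>M1\<close> to \<open>M4\<close> are those of tensors whose last slot is upper and
  whose other slots are lower. The first index of the result is the direction of differentiation.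
  Each operator is the one of rank one less, with the first slot of the tensor as a parameter,
  corrected by one Christoffel term for that slot. A statement about the last slots therefore extends
  to higher rank by moving one Christoffel term at a time past a sum.\<close>

definition D1 :: "('n \<Rightarrow> real^'n \<Rightarrow> real) \<Rightarrow> 'n \<Rightarrow> 'n \<Rightarrow> real^'n \<Rightarrow> real" where
  "D1 T l k = (\<lambda>x. pd l (T k) x - (\<Sum>m\<in>UNIV. \<Gamma> m l k x * T m x))"
definition D2 :: "('n \<Rightarrow> 'n \<Rightarrow> real^'n \<Rightarrow> real) \<Rightarrow> 'n \<Rightarrow> 'n \<Rightarrow> 'n \<Rightarrow> real^'n \<Rightarrow> real" where
  "D2 T l i k = (\<lambda>x. D1 (T i) l k x - (\<Sum>m\<in>UNIV. \<Gamma> m l i x * T m k x))"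
definition D3 :: "('n \<Rightarrow> 'n \<Rightarrow> 'n \<Rightarrow> real^'n \<Rightarrow> real) \<Rightarrow> 'n \<Rightarrow> 'n \<Rightarrow> 'n \<Rightarrow> 'n \<Rightarrow> real^'n \<Rightarrow> real" where
  "D3 T l j i k = (\<lambda>x. D2 (T j) l i k x - (\<Sum>m\<in>UNIV. \<Gamma> m l j x * T m i k x))"
definition D4 :: "('n \<Rightarrow> 'n \<Rightarrow> 'n \<Rightarrow> 'n \<Rightarrow> real^'n \<Rightarrow> real) \<Rightarrow> 'n \<Rightarrow> 'n \<Rightarrow> 'n \<Rightarrow> 'n \<Rightarrow> 'n \<Rightarrow> real^'n \<Rightarrow> real" where
  "D4 T l a j i k = (\<lambda>x. D3 (T a) l j i k x - (\<Sum>m\<in>UNIV. \<Gamma> m l a x * T m j i k x))"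

definition M1 :: "('n \<Rightarrow> real^'n \<Rightarrow> real) \<Rightarrow> 'n \<Rightarrow> 'n \<Rightarrow> real^'n \<Rightarrow> real" where
  "M1 V l k = (\<lambda>x. pd l (V k) x + (\<Sum>m\<in>UNIV. \<Gamma> k l m x * V m x))"
definition M2 :: "('n \<Rightarrow> 'n \<Rightarrow> real^'n \<Rightarrow> real) \<Rightarrow> 'n \<Rightarrow> 'n \<Rightarrow> 'n \<Rightarrow> real^'n \<Rightarrow> real" where
  "M2 T l i k = (\<lambda>x. M1 (T i) l k x - (\<Sum>m\<in>UNIV. \<Gamma> m l i x * T m k x))"
definition M3 :: "('n \<Rightarrow> 'n \<Rightarrow> 'n \<Rightarrow> real^'n \<Rightarrow> real) \<Rightarrow> 'n \<Rightarrow> 'n \<Rightarrow> 'n \<Rightarrow> 'n \<Rightarrow> real^'n \<Rightarrow> real" where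
  "M3 T l j i k = (\<lambda>x. M2 (T j) l i k x - (\<Sum>m\<in>UNIV. \<Gamma> m l j x * T m i k x))"
definition M4 :: "('n \<Rightarrow> 'n \<Rightarrow> 'n \<Rightarrow> 'n \<Rightarrow> real^'n \<Rightarrow> real) \<Rightarrow> 'n \<Rightarrow> 'n \<Rightarrow> 'n \<Rightarrow> 'n \<Rightarrow> 'n \<Rightarrow> real^'n \<Rightarrow> real" where
  "M4 T l a j i k = (\<lambda>x. M3 (T a) l j i k x - (\<Sum>m\<in>UNIV. \<Gamma> m l a x * T m j i k x))"

lemma sm_D1: "(\<And>k. sm (T k)) \<Longrightarrow> sm (D1 T l k)"
  unfolding D1_def by (intro sm_intros sm_\<Gamma>)
lemma sm_D2: "(\<And>i k. sm (T i k)) \<Longrightarrow> sm (D2 T l i k)"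
  unfolding D2_def by (intro sm_intros sm_\<Gamma> sm_D1)
lemma sm_M1: "(\<And>k. sm (T k)) \<Longrightarrow> sm (M1 T l k)"
  unfolding M1_def by (intro sm_intros sm_\<Gamma>)

lemma D1_cong:
  assumes "x \<in> U" "\<And>k. sm (T k)" "\<And>k y. y \<in> U \<Longrightarrow> T k y = T' k y"
  shows "D1 T l k x = D1 T' l k x"
  unfolding D1_def using pd_congU[OF assms(1,2,3)] assms(1,3) by simp

lemma D2_cong:
  assumes "x \<in> U" "\<And>i k. sm (T i k)" "\<And>i k y. y \<in> U \<Longrightarrow> T i k y = T' i k y"
  shows "D2 T l i k x = D2 T' l i k x"
  unfolding D2_def using D1_cong[OF assms(1), of "T i" "T' i"] assms by simp

lemma D3_cong:
  assumes "x \<in> U" "\<And>j i k. sm (T j i k)" "\<And>j i k y. y \<in> U \<Longrightarrow> T j i k y = T' j i k y"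
  shows "D3 T l j i k x = D3 T' l j i k x"
  unfolding D3_def using D2_cong[OF assms(1), of "T j" "T' j"] assms by simp

lemma D4_cong:
  assumes "x \<in> U" "\<And>a j i k. sm (T a j i k)" "\<And>a j i k y. y \<in> U \<Longrightarrow> T a j i k y = T' a j i k y"
  shows "D4 T l a j i k x = D4 T' l a j i k x"
  unfolding D4_def using D3_cong[OF assms(1), of "T a" "T' a"] assms by simp

text \<open>
  The product rule for a contraction: the Christoffel term of the upper slot and that of the
  lower slot cancel after exchanging the two summation indices.
\<close>

lemma pd_pairing:
  assumes x: "x \<in> U" and V: "\<And>p. sm (V p)" and T: "\<And>p. sm (T p)"
  shows "pd l (\<lambda>y. \<Sum>p\<in>UNIV. V p y * T p y) x
    = (\<Sum>p\<in>UNIV. M1 V l p x * T p x) + (\<Sum>p\<in>UNIV. V p x * D1 T l p x)"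
proof -
  have "(\<Sum>p\<in>UNIV. \<Sum>m\<in>UNIV. \<Gamma> p l m x * V m x * T p x) = (\<Sum>p\<in>UNIV. \<Sum>m\<in>UNIV. V p x * (\<Gamma> m l p x * T m x))"
    by (subst sum.swap) (simp add: mult_ac)
  moreover have "pd l (\<lambda>y. \<Sum>p\<in>UNIV. V p y * T p y) x
    = (\<Sum>p\<in>UNIV. pd l (V p) x * T p x) + (\<Sum>p\<in>UNIV. V p x * pd l (T p) x)"
    using V T by (simp add: pd_rules sm_intros x sum.distrib)
  ultimately show ?thesis
    by (simp add: M1_def D1_def distrib_right right_diff_distrib sum.distrib sum_subtractf sum_distrib_left sum_distrib_right)
qed

text \<open>
  A Christoffel term acting on a slot that takes no part in a contraction passes under the
  contraction.
\<close>

lemma sum_peel: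
  fixes c :: "'n \<Rightarrow> real"
  shows "(\<Sum>m\<in>UNIV. c m * (\<Sum>p\<in>UNIV. V p * T m p)) = (\<Sum>p\<in>UNIV. V p * (\<Sum>m\<in>UNIV. c m * T m p))"
  unfolding sum_distrib_left by (subst sum.swap) (simp add: mult_ac)

lemma sum_peel':
  fixes c :: "'n \<Rightarrow> real"
  shows "(\<Sum>m\<in>UNIV. c m * (\<Sum>p\<in>UNIV. T m p * V p)) = (\<Sum>p\<in>UNIV. (\<Sum>m\<in>UNIV. c m * T m p) * V p)"
  using sum_peel[of c V T] by (simp add: mult.commute)

lemma D1_contract:
  assumes x: "x \<in> U" and V: "\<And>p. sm (V p)" and T: "\<And>k p. sm (T k p)"
  shows "D1 (\<lambda>k y. \<Sum>p\<in>UNIV. V p y * T k p y) l k x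
    = (\<Sum>p\<in>UNIV. M1 V l p x * T k p x) + (\<Sum>p\<in>UNIV. V p x * D2 T l k p x)"
  unfolding D1_def[of "\<lambda>k y. \<Sum>p\<in>UNIV. V p y * T k p y"] pd_pairing[OF x V T]
  by (simp add: sum_peel[of "\<lambda>m. \<Gamma> m l k x"] D2_def right_diff_distrib sum_subtractf)

lemma D3_contract:
  assumes x: "x \<in> U" and w: "\<And>p. sm (w p)" and T: "\<And>a j i p. sm (T a j i p)"
  shows "D3 (\<lambda>a j i y. \<Sum>p\<in>UNIV. T a j i p y * w p y) l a j i x
    = (\<Sum>p\<in>UNIV. M4 T l a j i p x * w p x) + (\<Sum>p\<in>UNIV. T a j i p x * D1 w l p x)"
  by (simp add: D3_def D2_def D1_def[of "\<lambda>i y. \<Sum>p\<in>UNIV. T _ _ i p y * w p y"] pd_pairing[OF x T w] sum_peel'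
      M4_def M3_def M2_def left_diff_distrib sum_subtractf)

text \<open>Lowering an index commutes with covariant differentiation because the metric is parallel.\<close>

lemma D1_lower:
  assumes x: "x \<in> U" and V: "\<And>p. sm (V p)"
  shows "D1 (\<lambda>k y. \<Sum>p\<in>UNIV. g k p y * V p y) l k x = (\<Sum>p\<in>UNIV. g k p x * M1 V l p x)"
proof -
  have "(\<Sum>p\<in>UNIV. \<Sum>m\<in>UNIV. \<Gamma> m l p x * g k m x * V p x) = (\<Sum>p\<in>UNIV. \<Sum>m\<in>UNIV. g k p x * (\<Gamma> p l m x * V m x))"
    by (subst sum.swap) (simp add: mult_ac)
  moreover have "pd l (\<lambda>y. \<Sum>p\<in>UNIV. g k p y * V p y) x
    = (\<Sum>p\<in>UNIV. pd l (g k p) x * V p x) + (\<Sum>p\<in>UNIV. g k p x * pd l (V p) x)"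
    using V by (simp add: pd_rules sm_intros sm_g x sum.distrib)
  ultimately show ?thesis
    unfolding D1_def[of "\<lambda>k y. \<Sum>p\<in>UNIV. g k p y * V p y"] sum_peel'[of "\<lambda>m. \<Gamma> m l k x"]
    by (simp add: M1_def pd_g[OF x] distrib_left distrib_right sum.distrib sum_distrib_left sum_distrib_right)
qed

lemma D2_lower:
  assumes x: "x \<in> U" and T: "\<And>i p. sm (T i p)"
  shows "D2 (\<lambda>i k y. \<Sum>p\<in>UNIV. g k p y * T i p y) l i k x = (\<Sum>p\<in>UNIV. g k p x * M2 T l i p x)"
  by (simp add: D2_def D1_lower[OF x T] sum_peel[of "\<lambda>m. \<Gamma> m l n x" for n] M2_def right_diff_distrib sum_subtractf)

lemma D4_lower:
  assumes x: "x \<in> U" and T: "\<And>a j i p. sm (T a j i p)"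
  shows "D4 (\<lambda>a j i k y. \<Sum>p\<in>UNIV. g k p y * T a j i p y) l a j i k x = (\<Sum>p\<in>UNIV. g k p x * M4 T l a j i p x)"
  by (simp add: D4_def D3_def D2_def D1_lower[OF x T] sum_peel[of "\<lambda>m. \<Gamma> m l n x" for n] M2_def M3_def M4_def right_diff_distrib sum_subtractf)

lemma D2_g:
  assumes x: "x \<in> U"
  shows "D2 g l i k x = 0"
  by (simp add: D2_def D1_def pd_g[OF x] mult.commute)

text \<open>The inverse metric is parallel. A column of it, read as a vector field, has constant lowered
  components, so \<open>D1_lower\<close> computes its covariant derivative.\<close>

lemma pd_gi:
  assumes x: "x \<in> U"
  shows "pd a (gi m l) x = - (\<Sum>p\<in>UNIV. \<Gamma> m a p x * gi p l x) - (\<Sum>p\<in>UNIV. \<Gamma> l a p x * gi m p x)"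
proof -
  let ?d = "\<lambda>k (y::real^'n). (mat 1 :: real^'n^'n) $ k $ l"
  have "(\<Sum>p\<in>UNIV. g k p x * M1 (\<lambda>p. gi p l) a p x) = D1 (\<lambda>k y. \<Sum>p\<in>UNIV. g k p y * gi p l y) a k x" for k
    by (rule D1_lower[OF x sm_gi, symmetric])
  also have "\<dots> k = D1 ?d a k x" for k
    by (rule D1_cong[OF x]) (auto intro!: sm_intros sm_g sm_gi simp: G_inverse(1)[symmetric] matrix_matrix_mult_def)
  also have "\<dots> k = - \<Gamma> l a k x" for k
    by (simp add: D1_def pd_const mat_def if_distrib[of "\<lambda>z. _ * z"] cong: if_cong)
  finally have "M1 (\<lambda>p. gi p l) a m x = (\<Sum>k\<in>UNIV. gi m k x * (- \<Gamma> l a k x))"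
    using raise_lower[OF x, of m "\<lambda>p. M1 (\<lambda>p. gi p l) a p x"] by simp
  then show ?thesis by (simp add: M1_def sum_negf mult.commute)
qed

lemma D1_metric_contract:
  assumes x: "x \<in> U" and T: "\<And>m l k. sm (T m l k)"
  shows "D1 (\<lambda>k y. \<Sum>m\<in>UNIV. \<Sum>l\<in>UNIV. gi m l y * T m l k y) a k x
    = (\<Sum>m\<in>UNIV. \<Sum>l\<in>UNIV. gi m l x * D3 T a m l k x)"
proof -
  have 1: "(\<Sum>m\<in>UNIV. \<Sum>l\<in>UNIV. \<Sum>p\<in>UNIV. \<Gamma> m a p x * gi p l x * T m l k x)
      = (\<Sum>m\<in>UNIV. \<Sum>l\<in>UNIV. \<Sum>p\<in>UNIV. gi m l x * (\<Gamma> p a m x * T p l k x))"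
    (is "?L = _")
  proof -
    have "?L = (\<Sum>l\<in>UNIV. \<Sum>m\<in>UNIV. \<Sum>p\<in>UNIV. \<Gamma> m a p x * gi p l x * T m l k x)"
      by (rule sum.swap)
    also have "\<dots> = (\<Sum>l\<in>UNIV. \<Sum>p\<in>UNIV. \<Sum>m\<in>UNIV. \<Gamma> m a p x * gi p l x * T m l k x)"
      by (rule sum.cong[OF refl sum.swap])
    also have "\<dots> = (\<Sum>p\<in>UNIV. \<Sum>l\<in>UNIV. \<Sum>m\<in>UNIV. \<Gamma> m a p x * gi p l x * T m l k x)"
      by (rule sum.swap)
    finally show ?thesis by (simp add: mult_ac)
  qed
  have 2: "(\<Sum>m\<in>UNIV. \<Sum>l\<in>UNIV. \<Sum>p\<in>UNIV. \<Gamma> l a p x * gi m p x * T m l k x)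
      = (\<Sum>m\<in>UNIV. \<Sum>l\<in>UNIV. \<Sum>p\<in>UNIV. gi m l x * (\<Gamma> p a l x * T m p k x))"
    by (rule sum.cong[OF refl], subst sum.swap) (simp add: mult_ac)
  have 3: "(\<Sum>n\<in>UNIV. \<Gamma> n a k x * (\<Sum>m\<in>UNIV. \<Sum>l\<in>UNIV. gi m l x * T m l n x))
      = (\<Sum>m\<in>UNIV. \<Sum>l\<in>UNIV. gi m l x * (\<Sum>n\<in>UNIV. \<Gamma> n a k x * T m l n x))"
  proof -
    have "(\<Sum>n\<in>UNIV. \<Gamma> n a k x * (\<Sum>m\<in>UNIV. \<Sum>l\<in>UNIV. gi m l x * T m l n x))
        = (\<Sum>m\<in>UNIV. \<Sum>n\<in>UNIV. \<Gamma> n a k x * (\<Sum>l\<in>UNIV. gi m l x * T m l n x))"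
      unfolding sum_distrib_left[of _ "\<lambda>m. \<Sum>l\<in>UNIV. _ m l"] by (rule sum.swap)
    then show ?thesis by (simp add: sum_peel[of "\<lambda>m. \<Gamma> m a k x"])
  qed
  have 4: "pd a (\<lambda>y. \<Sum>m\<in>UNIV. \<Sum>l\<in>UNIV. gi m l y * T m l k y) x
      = (\<Sum>m\<in>UNIV. \<Sum>l\<in>UNIV. pd a (gi m l) x * T m l k x) + (\<Sum>m\<in>UNIV. \<Sum>l\<in>UNIV. gi m l x * pd a (T m l k) x)"
    using T by (simp add: pd_rules sm_intros sm_gi x sum.distrib)
  have 5: "(\<Sum>m\<in>UNIV. \<Sum>l\<in>UNIV. pd a (gi m l) x * T m l k x)
      = - (\<Sum>m\<in>UNIV. \<Sum>l\<in>UNIV. \<Sum>p\<in>UNIV. \<Gamma> m a p x * gi p l x * T m l k x)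
        - (\<Sum>m\<in>UNIV. \<Sum>l\<in>UNIV. \<Sum>p\<in>UNIV. \<Gamma> l a p x * gi m p x * T m l k x)"
    by (simp add: pd_gi[OF x] left_diff_distrib sum_subtractf sum_negf sum_distrib_right)
  show ?thesis
    unfolding D1_def[of "\<lambda>k y. \<Sum>m\<in>UNIV. \<Sum>l\<in>UNIV. gi m l y * T m l k y"] 3 4 5 1 2
    by (simp add: D3_def D2_def D1_def right_diff_distrib sum_subtractf sum_distrib_left)
qed

lemma D2_trace:
  assumes x: "x \<in> U" and T: "\<And>m i k p. sm (T m i k p)"
  shows "D2 (\<lambda>i k y. \<Sum>m\<in>UNIV. T m i k m y) l i k x = (\<Sum>m\<in>UNIV. M4 T l m i k m x)"
proof -
  have 1: "(\<Sum>m\<in>UNIV. \<Sum>p\<in>UNIV. \<Gamma> p l m x * T p i k m x) = (\<Sum>m\<in>UNIV. \<Sum>p\<in>UNIV. \<Gamma> m l p x * T m i k p x)"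
    by (rule sum.swap)
  have 2: "(\<Sum>p\<in>UNIV. c p * (\<Sum>m\<in>UNIV. S p m)) = (\<Sum>m\<in>UNIV. \<Sum>p\<in>UNIV. c p * S p m)" for c :: "'n \<Rightarrow> real" and S
    unfolding sum_distrib_left by (rule sum.swap)
  show ?thesis
    using T 1 by (simp add: D2_def D1_def pd_rules x M4_def M3_def M2_def M1_def 2 sum.distrib sum_subtractf)
qed

section \<open>Curvature\<close>

abbreviation Rup :: "'n \<Rightarrow> 'n \<Rightarrow> 'n \<Rightarrow> 'n \<Rightarrow> real^'n \<Rightarrow> real" where "Rup \<equiv> riemann_up G"

text \<open>The lowered index comes last here, so that the lowering lemmas apply; in terms of the order with
  \<open>Ric\<^sub>i\<^sub>k = g\<^sup>j\<^sup>l R\<^sub>i\<^sub>j\<^sub>k\<^sub>l\<close> this is \<open>R\<^sub>i\<^sub>j\<^sub>l\<^sub>k\<close>.\<close>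

definition Rlow :: "'n \<Rightarrow> 'n \<Rightarrow> 'n \<Rightarrow> 'n \<Rightarrow> real^'n \<Rightarrow> real" where
  "Rlow i j k l = (\<lambda>x. \<Sum>p\<in>UNIV. g l p x * Rup i j k p x)"

lemma sm_Rup: "sm (Rup i j k l)"
  unfolding riemann_up_def[abs_def] by (intro sm_intros sm_\<Gamma>)

lemma sm_Rlow: "sm (Rlow i j k l)"
  unfolding Rlow_def by (intro sm_intros sm_g sm_Rup)

text \<open>The common algebra of all commutators of covariant derivatives. \<open>E m l\<close> is a second
  derivative in directions \<open>m\<close>, \<open>l\<close> split into the part \<open>X\<close> that ignores the slot \<open>i\<close> and the Christoffel
  terms of that slot: \<open>t\<close> are the components in this slot and \<open>d\<close> their derivatives. The terms with
  \<open>d\<close> are symmetric in \<open>m\<close> and \<open>l\<close>; what remains is the curvature acting on the slot.\<close>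

lemma slot_curvature:
  fixes X :: "'n \<Rightarrow> 'n \<Rightarrow> real" and d :: "'n \<Rightarrow> 'n \<Rightarrow> real" and t :: "'n \<Rightarrow> real" and x :: "real^'n" and i m l :: 'n
  defines "E \<equiv> \<lambda>m l. X m l - (\<Sum>q\<in>UNIV. pd m (\<Gamma> q l i) x * t q + \<Gamma> q l i x * d m q)
    - (\<Sum>p\<in>UNIV. \<Gamma> p m i x * (d l p - (\<Sum>q\<in>UNIV. \<Gamma> q l p x * t q)))"
  shows "E m l - E l m = X m l - X l m - (\<Sum>q\<in>UNIV. Rup m l i q x * t q)"
proof -
  have quad: "(\<Sum>p\<in>UNIV. \<Gamma> p a i x * (\<Sum>q\<in>UNIV. \<Gamma> q b p x * t q))
      = (\<Sum>q\<in>UNIV. (\<Sum>p\<in>UNIV. \<Gamma> q b p x * \<Gamma> p a i x) * t q)" for a b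
    unfolding sum_distrib_left sum_distrib_right by (subst sum.swap) (simp add: mult_ac)
  show ?thesis
    unfolding E_def right_diff_distrib sum_subtractf quad riemann_up_def distrib_right left_diff_distrib sum.distrib
    by simp
qed

text \<open>The direction slots are parameters here and get no Christoffel term. The Ricci identities below
  follow because the omitted terms are symmetric in the two directions.\<close>

lemma D1_commutator:
  assumes x: "x \<in> U" and w: "\<And>k. sm (w k)"
  shows "D1 (D1 w l) m k x - D1 (D1 w m) l k x = - (\<Sum>p\<in>UNIV. Rup m l k p x * w p x)"
proof -
  have "D1 (D1 w b) a k x = pd a (pd b (w k)) x
      - (\<Sum>q\<in>UNIV. pd a (\<Gamma> q b k) x * w q x + \<Gamma> q b k x * pd a (w q) x)
      - (\<Sum>p\<in>UNIV. \<Gamma> p a k x * (pd b (w p) x - (\<Sum>q\<in>UNIV. \<Gamma> q b p x * w q x)))" for a b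
    using w by (simp add: D1_def pd_rules sm_intros sm_\<Gamma> x)
  then show ?thesis
    using slot_curvature[where X="\<lambda>a b. pd a (pd b (w k)) x" and i=k and x=x and t="\<lambda>q. w q x"
      and d="\<lambda>a q. pd a (w q) x" and m=m and l=l]
      pd_commute[OF open_U x w] by simp
qed

lemma D2_commutator:
  assumes x: "x \<in> U" and T: "\<And>i k. sm (T i k)"
  shows "D2 (D2 T l) m i k x - D2 (D2 T m) l i k x
    = - (\<Sum>p\<in>UNIV. Rup m l i p x * T p k x) - (\<Sum>p\<in>UNIV. Rup m l k p x * T i p x)"
proof -
  have "D1 (D2 T b i) a k x = D1 (D1 (T i) b) a k x
      - (\<Sum>q\<in>UNIV. pd a (\<Gamma> q b i) x * T q k x + \<Gamma> q b i x * D1 (T q) a k x)" for a b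
  proof -
    have "pd a (D2 T b i k) x = pd a (D1 (T i) b k) x
        - (\<Sum>q\<in>UNIV. pd a (\<Gamma> q b i) x * T q k x + \<Gamma> q b i x * pd a (T q k) x)"
      unfolding D2_def using T by (simp add: pd_rules sm_intros sm_\<Gamma> sm_D1 x)
    moreover have "(\<Sum>p\<in>UNIV. \<Gamma> p a k x * (\<Sum>q\<in>UNIV. \<Gamma> q b i x * T q p x))
        = (\<Sum>q\<in>UNIV. \<Gamma> q b i x * (\<Sum>p\<in>UNIV. \<Gamma> p a k x * T q p x))"
      by (rule sum_peel[where T = "\<lambda>m p. T p m x"])
    ultimately show ?thesis
      by (simp add: D1_def[of "D2 T b i"] D1_def[of "D1 (T i) b"] D2_def D1_def[of "T _" a] right_diff_distrib
          sum.distrib sum_subtractf)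
  qed
  then have "D2 (D2 T b) a i k x = D1 (D1 (T i) b) a k x
      - (\<Sum>q\<in>UNIV. pd a (\<Gamma> q b i) x * T q k x + \<Gamma> q b i x * D1 (T q) a k x)
      - (\<Sum>p\<in>UNIV. \<Gamma> p a i x * (D1 (T p) b k x - (\<Sum>q\<in>UNIV. \<Gamma> q b p x * T q k x)))" for a b
    by (simp add: D2_def)
  then show ?thesis
    using slot_curvature[where X="\<lambda>a b. D1 (D1 (T i) b) a k x" and i=i and x=x and t="\<lambda>q. T q k x"
      and d="\<lambda>a q. D1 (T q) a k x" and m=m and l=l]
      D1_commutator[where w="T i", OF x T] by simp
qed

lemma ricci_identity_1:
  assumes x: "x \<in> U" and w: "\<And>k. sm (w k)"
  shows "D2 (D1 w) m l k x - D2 (D1 w) l m k x = - (\<Sum>p\<in>UNIV. Rup m l k p x * w p x)"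
  using D1_commutator[where w=w, OF x w] by (simp add: D2_def \<Gamma>_sym[OF x, of _ m l])

lemma ricci_identity_2:
  assumes x: "x \<in> U" and T: "\<And>i k. sm (T i k)"
  shows "D3 (D2 T) m l i k x - D3 (D2 T) l m i k x
    = - (\<Sum>p\<in>UNIV. Rup m l i p x * T p k x) - (\<Sum>p\<in>UNIV. Rup m l k p x * T i p x)"
  using D2_commutator[where T=T, OF x T] by (simp add: D3_def \<Gamma>_sym[OF x, of _ m l])

lemma Rup_antisym: "Rup i j k l x = - Rup j i k l x"
  by (simp add: riemann_up_def sum_subtractf)

lemma first_bianchi:
  assumes x: "x \<in> U"
  shows "Rup i j k l x + Rup j k i l x + Rup k i j l x = 0"
proof -
  have pd\<Gamma>: "pd a (\<Gamma> l b c) x = pd a (\<Gamma> l c b) x" for a b c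
    by (rule pd_congU[OF x sm_\<Gamma> \<Gamma>_sym])
  show ?thesis
    by (simp add: riemann_up_def sum_subtractf pd\<Gamma>[of _ j i] pd\<Gamma>[of _ k i] pd\<Gamma>[of _ k j]
        \<Gamma>_sym[OF x, of _ j i] \<Gamma>_sym[OF x, of _ k i] \<Gamma>_sym[OF x, of _ k j])
qed

text \<open>The covariant derivative of the Ricci identity for \<open>w\<close>. It expresses the exchange of the two inner
  derivatives, where \<open>ricci_identity_2\<close> exchanges the two outer ones.\<close>

lemma D3_curvature:
  assumes x: "x \<in> U" and w: "\<And>k. sm (w k)"
  shows "D3 (D2 (D1 w)) m l i k x - D3 (D2 (D1 w)) m i l k x
    = - (\<Sum>p\<in>UNIV. M4 Rup m l i k p x * w p x) - (\<Sum>p\<in>UNIV. Rup l i k p x * D1 w m p x)"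
proof -
  let ?C = "D2 (D1 w)"
  have sm_C: "sm (?C a b c)" for a b c by (intro sm_D2 sm_D1 w)
  have "D3 (\<lambda>l i k y. ?C i l k y - ?C l i k y) m l i k x = D3 ?C m i l k x - D3 ?C m l i k x"
    using sm_C by (simp add: D3_def D2_def[of "_ :: 'n \<Rightarrow> 'n \<Rightarrow> real^'n \<Rightarrow> real" m] D1_def[of _ m] pd_rules x
        right_diff_distrib sum_subtractf)
  moreover have "D3 (\<lambda>l i k y. ?C i l k y - ?C l i k y) m l i k x = D3 (\<lambda>l i k y. \<Sum>p\<in>UNIV. Rup l i k p y * w p y) m l i k x"
  proof (rule D3_cong[OF x])
    show "sm (\<lambda>y. ?C i l k y - ?C l i k y)" for l i k by (intro sm_intros sm_C)
    show "?C i l k y - ?C l i k y = (\<Sum>p\<in>UNIV. Rup l i k p y * w p y)" if "y \<in> U" for l i k y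
      using ricci_identity_1[where w=w, OF that w, of l i k] by simp
  qed
  ultimately show ?thesis using D3_contract[where T=Rup and w=w, OF x w sm_Rup, of m l i k] by simp
qed

text \<open>This is the Jacobi identity for covariant derivatives. The antisymmetrisation of
  \<open>D\<^sub>m D\<^sub>i D\<^sub>j w\<close> over the three directions can be grouped by inner or by outer commutators. Comparing
  the groupings leaves the cyclic sum of \<open>D Rup\<close> applied to \<open>w\<close>; covectors with constant components
  separate its entries.\<close>

lemma second_bianchi:
  assumes x: "x \<in> U"
  shows "M4 Rup m i j k l x + M4 Rup i j m k l x + M4 Rup j m i k l x = 0"
proof -
  \<comment> \<open>the constant covector dual to the coordinate vector \<open>l\<close>\<close>
  define w :: "'n \<Rightarrow> real^'n \<Rightarrow> real" where "w = (\<lambda>p y. (mat 1 :: real^'n^'n) $ l $ p)"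
  have w: "sm (w p)" for p by (simp add: w_def sm_intros)
  have D1w: "sm (D1 w p q)" for p q by (intro sm_D1 w)
  have "(\<Sum>p\<in>UNIV. M4 Rup m i j k p x * w p x) + (\<Sum>p\<in>UNIV. M4 Rup i j m k p x * w p x)
      + (\<Sum>p\<in>UNIV. M4 Rup j m i k p x * w p x)
      = (\<Sum>p\<in>UNIV. Rup m i j p x * D1 w p k x) + (\<Sum>p\<in>UNIV. Rup i j m p x * D1 w p k x)
      + (\<Sum>p\<in>UNIV. Rup j m i p x * D1 w p k x)"
    using D3_curvature[where w=w, OF x w, of m i j k] D3_curvature[where w=w, OF x w, of i j m k] D3_curvature[where w=w, OF x w, of j m i k]
      ricci_identity_2[where T="D1 w", OF x D1w, of m i j k] ricci_identity_2[where T="D1 w", OF x D1w, of i j m k]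
      ricci_identity_2[where T="D1 w", OF x D1w, of j m i k]
    by linarith
  also have "\<dots> = (\<Sum>p\<in>UNIV. (Rup m i j p x + Rup i j m p x + Rup j m i p x) * D1 w p k x)"
    by (simp add: distrib_right sum.distrib)
  also have "\<dots> = 0" by (simp add: first_bianchi[OF x])
  finally show ?thesis
    using sum_mat_1[of l] by (simp add: w_def mult.commute)
qed

lemma Rlow_antisym_12: "Rlow i j k l x = - Rlow j i k l x"
  by (simp add: Rlow_def Rup_antisym[of i j] sum_negf)

text \<open>The Ricci identity applied to the metric, whose covariant derivative vanishes.\<close>

lemma Rlow_antisym_34:
  assumes x: "x \<in> U"
  shows "Rlow i j k l x = - Rlow i j l k x"
proof -
  have "D3 (D2 g) a b i k x = D3 (\<lambda>_ _ _ _. 0) a b i k x" for a b i k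
    by (rule D3_cong[OF x]) (auto intro: sm_D2 sm_g D2_g)
  then have "D3 (D2 g) a b i k x = 0" for a b i k
    by (simp add: D3_def D2_def D1_def pd_const)
  then have "(\<Sum>p\<in>UNIV. Rup i j k p x * g p l x) + (\<Sum>p\<in>UNIV. Rup i j l p x * g k p x) = 0"
    using ricci_identity_2[where T=g, OF x sm_g, of i j k l] by simp
  then show ?thesis
    by (simp add: Rlow_def mult.commute g_sym[OF x, of _ l])
qed

lemma Rlow_bianchi:
  assumes x: "x \<in> U"
  shows "Rlow i j k l x + Rlow j k i l x + Rlow k i j l x = 0"
proof -
  have "Rlow i j k l x + Rlow j k i l x + Rlow k i j l x = (\<Sum>p\<in>UNIV. g l p x * (Rup i j k p x + Rup j k i p x + Rup k i j p x))"
    by (simp add: Rlow_def distrib_left sum.distrib)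
  then show ?thesis by (simp add: first_bianchi[OF x])
qed

text \<open>The classical octahedron argument: four instances of the first Bianchi identity, with signs
  adjusted by the two antisymmetries.\<close>

lemma Rlow_pair:
  assumes x: "x \<in> U"
  shows "Rlow i j k l x = Rlow k l i j x"
  using Rlow_bianchi[OF x, of i j k l] Rlow_bianchi[OF x, of j k l i] Rlow_bianchi[OF x, of k l i j]
    Rlow_bianchi[OF x, of l i j k] Rlow_antisym_34[OF x, of j k l i] Rlow_antisym_34[OF x, of k l j i]
    Rlow_antisym_12[of i k l j x] Rlow_antisym_34[OF x, of k i l j] Rlow_antisym_34[OF x, of l i j k]
    Rlow_antisym_34[OF x, of i j l k] Rlow_antisym_12[of j l i k x] Rlow_antisym_34[OF x, of l j i k]
  by linarith

lemma M4_antisym: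
  assumes x: "x \<in> U"
  shows "M4 Rup l a j i k x = - M4 Rup l j a i k x"
proof -
  have "Rup b c d e = (\<lambda>y. - Rup c b d e y)" for b c d e
    using Rup_antisym by blast
  then have "pd l (Rup a j i k) x = - pd l (Rup j a i k) x"
    using pd_minus[OF x sm_Rup, of l j a i k] by metis
  then show ?thesis
    by (simp add: M4_def M3_def M2_def M1_def Rup_antisym[of a] Rup_antisym[of _ j] sum_negf)
qed

lemma D4_Rlow:
  assumes x: "x \<in> U"
  shows "D4 Rlow m l i k q x = (\<Sum>p\<in>UNIV. g q p x * M4 Rup m l i k p x)"
  using D4_lower[where T=Rup, OF x sm_Rup] by (simp add: Rlow_def[abs_def])

text \<open>The slot \<open>l\<close> moves to the last position, where it is the lowered one. Contracting it with the direction
  \<open>m\<close> through the inverse metric then becomes a plain trace.\<close>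

lemma D4_Rlow_swap:
  assumes x: "x \<in> U"
  shows "D4 Rlow m l i k q x = - D4 Rlow m k q i l x"
proof -
  have "D4 Rlow m l i k q x = D4 (\<lambda>a b c d y. - Rlow c d b a y) m l i k q x"
    by (rule D4_cong[OF x sm_Rlow]) (metis Rlow_pair Rlow_antisym_34)
  then show ?thesis
    by (simp add: D4_def D3_def D2_def D1_def pd_minus[OF x sm_Rlow] sum_negf)
qed

text \<open>The Ricci tensor as the trace over an upper and a lower slot. The Christoffel terms of these two
  slots cancel under differentiation; \<open>ricci_eq\<close> identifies the trace with the metric
  contraction.\<close>

definition Ric :: "'n \<Rightarrow> 'n \<Rightarrow> real^'n \<Rightarrow> real" where
  "Ric i k = (\<lambda>x. \<Sum>m\<in>UNIV. Rup m i k m x)"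

lemma sm_Ric: "sm (Ric i k)"
  unfolding Ric_def by (intro sm_intros sm_Rup)

lemma contracted_bianchi:
  assumes x: "x \<in> U"
  shows "(\<Sum>m\<in>UNIV. M4 Rup m k q i m x) = D2 Ric k q i x - D2 Ric q k i x"
proof -
  have R: "D2 Ric l i k x = (\<Sum>m\<in>UNIV. M4 Rup l m i k m x)" for l i k
    using D2_trace[where T=Rup, OF x sm_Rup] by (simp add: Ric_def[abs_def])
  have "M4 Rup m k q i m x = M4 Rup k m q i m x - M4 Rup q m k i m x" for m
    using second_bianchi[OF x, of m k q i m] M4_antisym[OF x, of k q m i m] by linarith
  then show ?thesis by (simp add: R sum_subtractf)
qed

lemma metric_contract_lower:
  assumes x: "x \<in> U"
  shows "(\<Sum>m\<in>UNIV. \<Sum>l\<in>UNIV. gi m l x * (\<Sum>s\<in>UNIV. g l s x * N m s)) = (\<Sum>m\<in>UNIV. N m m)"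
  by (rule sum.cong[OF refl]) (rule raise_lower[OF x])

lemma sum_pull:
  fixes c :: "'n \<Rightarrow> 'n \<Rightarrow> real"
  shows "(\<Sum>m\<in>UNIV. \<Sum>l\<in>UNIV. c m l * (\<Sum>p\<in>UNIV. A m l p * b p)) = (\<Sum>p\<in>UNIV. (\<Sum>m\<in>UNIV. \<Sum>l\<in>UNIV. c m l * A m l p) * b p)"
proof -
  have "(\<Sum>m\<in>UNIV. \<Sum>l\<in>UNIV. c m l * (\<Sum>p\<in>UNIV. A m l p * b p)) = (\<Sum>m\<in>UNIV. \<Sum>p\<in>UNIV. \<Sum>l\<in>UNIV. c m l * (A m l p * b p))"
    unfolding sum_distrib_left by (rule sum.cong[OF refl sum.swap])
  also have "\<dots> = (\<Sum>p\<in>UNIV. \<Sum>m\<in>UNIV. \<Sum>l\<in>UNIV. c m l * (A m l p * b p))"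
    by (rule sum.swap)
  finally show ?thesis by (simp add: sum_distrib_right mult.assoc)
qed

lemma metric_trace_Rup:
  assumes x: "x \<in> U"
  shows "(\<Sum>m\<in>UNIV. \<Sum>l\<in>UNIV. gi m l x * Rup m i l p x) = - (\<Sum>q\<in>UNIV. gi p q x * Ric i q x)"
proof -
  have "Rup m i l p x = (\<Sum>q\<in>UNIV. Rlow m i l q x * gi p q x)" for m l
    using raise_lower[OF x, of p "\<lambda>p. Rup m i l p x"] by (simp add: Rlow_def mult.commute)
  then have "(\<Sum>m\<in>UNIV. \<Sum>l\<in>UNIV. gi m l x * Rup m i l p x)
      = (\<Sum>q\<in>UNIV. (\<Sum>m\<in>UNIV. \<Sum>l\<in>UNIV. gi m l x * Rlow m i l q x) * gi p q x)"
    by (simp add: sum_pull)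
  moreover have "(\<Sum>m\<in>UNIV. \<Sum>l\<in>UNIV. gi m l x * Rlow m i l q x) = - Ric i q x" for q
  proof -
    have "Rlow m i l q x = - (\<Sum>s\<in>UNIV. g l s x * Rup m i q s x)" for m l
      using Rlow_antisym_34[OF x, of m i l q] by (simp add: Rlow_def)
    then show ?thesis
      using metric_contract_lower[OF x, of "\<lambda>m s. Rup m i q s x"] by (simp add: Ric_def sum_negf)
  qed
  ultimately show ?thesis by (simp add: sum_negf mult.commute)
qed

text \<open>A divergence of the curvature tensor in its first slot. Pair symmetry turns it into the trace
  of \<open>contracted_bianchi\<close>.\<close>

lemma divergence_Rup:
  assumes x: "x \<in> U"
  shows "(\<Sum>m\<in>UNIV. \<Sum>l\<in>UNIV. gi m l x * (\<Sum>p\<in>UNIV. M4 Rup m l i k p x * (\<Sum>q\<in>UNIV. g p q x * V q)))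
    = - (\<Sum>q\<in>UNIV. (D2 Ric k q i x - D2 Ric q k i x) * V q)"
proof -
  have "(\<Sum>p\<in>UNIV. M4 Rup m l i k p x * (\<Sum>q\<in>UNIV. g p q x * V q)) = (\<Sum>q\<in>UNIV. D4 Rlow m l i k q x * V q)" for m l
    unfolding D4_Rlow[OF x] sum_distrib_left sum_distrib_right
    by (subst sum.swap) (simp add: mult_ac g_sym[OF x])
  then have "(\<Sum>m\<in>UNIV. \<Sum>l\<in>UNIV. gi m l x * (\<Sum>p\<in>UNIV. M4 Rup m l i k p x * (\<Sum>q\<in>UNIV. g p q x * V q)))
      = (\<Sum>q\<in>UNIV. (\<Sum>m\<in>UNIV. \<Sum>l\<in>UNIV. gi m l x * D4 Rlow m l i k q x) * V q)"
    by (simp add: sum_pull)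
  moreover have "(\<Sum>m\<in>UNIV. \<Sum>l\<in>UNIV. gi m l x * D4 Rlow m l i k q x) = - (D2 Ric k q i x - D2 Ric q k i x)" for q
  proof -
    have "D4 Rlow m l i k q x = - (\<Sum>s\<in>UNIV. g l s x * M4 Rup m k q i s x)" for m l
      using D4_Rlow_swap[OF x, of m l i k q] D4_Rlow[OF x, of m k q i l] by simp
    then show ?thesis
      using metric_contract_lower[OF x, of "\<lambda>m s. M4 Rup m k q i s x"]
      by (simp add: contracted_bianchi[OF x] sum_negf)
  qed
  ultimately show ?thesis by (simp only: mult_minus_left sum_negf)
qed

text \<open>Commuting the Laplacian past a covariant derivative of a covector field \<open>w\<close>. The directions in
  \<open>D\<^sub>m D\<^sub>l D\<^sub>i w\<close> are moved in two steps to \<open>D\<^sub>i D\<^sub>m D\<^sub>l w\<close>: \<open>D3_curvature\<close> exchanges \<open>l\<close> and \<open>i\<close>,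
  \<open>ricci_identity_2\<close> exchanges \<open>m\<close> and \<open>i\<close>. Each step leaves one full curvature term, which agree after
  contraction, and they also leave a Ricci term and a divergence of curvature.\<close>

lemma laplacian_commutation:
  assumes x: "x \<in> U" and w: "\<And>k. sm (w k)" and V: "\<And>p. w p x = (\<Sum>q\<in>UNIV. g p q x * V q)"
  shows "(\<Sum>m\<in>UNIV. \<Sum>l\<in>UNIV. gi m l x * D3 (D2 (D1 w)) m l i k x)
    = D1 (\<lambda>k y. \<Sum>m\<in>UNIV. \<Sum>l\<in>UNIV. gi m l y * D2 (D1 w) m l k y) i k x
      + (\<Sum>p\<in>UNIV. (\<Sum>q\<in>UNIV. gi p q x * Ric i q x) * D1 w p k x)
      - 2 * (\<Sum>m\<in>UNIV. \<Sum>l\<in>UNIV. gi m l x * (\<Sum>p\<in>UNIV. Rup l i k p x * D1 w m p x))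
      + (\<Sum>q\<in>UNIV. (D2 Ric k q i x - D2 Ric q k i x) * V q)"
proof -
  let ?C = "D2 (D1 w)" and ?B = "D1 w"
  have B: "sm (?B a b)" for a b by (intro sm_D1 w)
  have C: "sm (?C a b c)" for a b c by (intro sm_D2 B)
  have "D3 ?C m l i k x = D3 ?C i m l k x
      - (\<Sum>p\<in>UNIV. Rup m i l p x * ?B p k x) - (\<Sum>p\<in>UNIV. Rup m i k p x * ?B l p x)
      - (\<Sum>p\<in>UNIV. M4 Rup m l i k p x * w p x) - (\<Sum>p\<in>UNIV. Rup l i k p x * ?B m p x)" for m l
    using ricci_identity_2[where T="?B", OF x B, of m i l k] D3_curvature[where w=w, OF x w, of m l i k] by linarith
  then have "(\<Sum>m\<in>UNIV. \<Sum>l\<in>UNIV. gi m l x * D3 ?C m l i k x)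
      = (\<Sum>m\<in>UNIV. \<Sum>l\<in>UNIV. gi m l x * D3 ?C i m l k x)
      - (\<Sum>m\<in>UNIV. \<Sum>l\<in>UNIV. gi m l x * (\<Sum>p\<in>UNIV. Rup m i l p x * ?B p k x))
      - (\<Sum>m\<in>UNIV. \<Sum>l\<in>UNIV. gi m l x * (\<Sum>p\<in>UNIV. Rup m i k p x * ?B l p x))
      - (\<Sum>m\<in>UNIV. \<Sum>l\<in>UNIV. gi m l x * (\<Sum>p\<in>UNIV. M4 Rup m l i k p x * w p x))
      - (\<Sum>m\<in>UNIV. \<Sum>l\<in>UNIV. gi m l x * (\<Sum>p\<in>UNIV. Rup l i k p x * ?B m p x))"
    by (simp add: right_diff_distrib sum_subtractf)
  moreover have "(\<Sum>m\<in>UNIV. \<Sum>l\<in>UNIV. gi m l x * (\<Sum>p\<in>UNIV. Rup m i k p x * ?B l p x))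
      = (\<Sum>m\<in>UNIV. \<Sum>l\<in>UNIV. gi m l x * (\<Sum>p\<in>UNIV. Rup l i k p x * ?B m p x))"
    by (subst sum.swap) (simp only: gi_sym[OF x])
  moreover have "(\<Sum>m\<in>UNIV. \<Sum>l\<in>UNIV. gi m l x * (\<Sum>p\<in>UNIV. Rup m i l p x * ?B p k x))
      = - (\<Sum>p\<in>UNIV. (\<Sum>q\<in>UNIV. gi p q x * Ric i q x) * ?B p k x)"
    by (simp add: sum_pull metric_trace_Rup[OF x] sum_negf)
  ultimately show ?thesis
    using divergence_Rup[OF x, of i k V] D1_metric_contract[where T="?C", OF x C, of i k]
    by (simp only: V)
qed

section \<open>Classical operators in terms of covariant derivatives\<close>

lemma ricci_eq:
  assumes x: "x \<in> U"
  shows "ricci G x $ i $ k = Ric i k x"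
proof -
  have "riemann G i j k l x = (\<Sum>s\<in>UNIV. g l s x * Rup j i k s x)" for j l
    using Rlow_antisym_34[OF x, of i j l k] Rlow_antisym_12[of i j k l x]
    by (simp add: riemann_def Rlow_def)
  then show ?thesis
    using metric_contract_lower[OF x, of "\<lambda>j s. Rup j i k s x"] by (simp add: ricci_def Ric_def)
qed

lemma hessian_eq: "hessian G F x $ i $ j = D1 (\<lambda>k. pd k F) i j x"
  by (simp add: hessian_def D1_def)

lemma cov_vec_eq: "cov_vec G V j i = M1 (\<lambda>p y. V y $ p) j i"
  by (simp add: cov_vec_def[abs_def] M1_def)

lemma cov2_vec_eq: "cov2_vec G V j k i = M2 (M1 (\<lambda>p y. V y $ p)) j k i"
  by (simp add: cov2_vec_def[abs_def] M2_def M1_def[of "M1 _ _"] cov_vec_eq)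

lemma cov_ten_eq: "cov_ten G H l i k = D2 (\<lambda>i k y. H y $ i $ k) l i k"
  by (simp add: cov_ten_def[abs_def] D2_def D1_def algebra_simps)

lemma cov2_ten_eq: "cov2_ten G H m l i k = D3 (D2 (\<lambda>i k y. H y $ i $ k)) m l i k"
  by (simp add: cov2_ten_def[abs_def] cov_ten_eq D3_def D2_def[of "D2 _ _"] D1_def[of "D2 _ _ _"] algebra_simps)

text \<open>The Christoffel terms cancel by symmetry in the lower indices, so partial derivatives may be
  replaced by covariant ones.\<close>

lemma lie_ten_eq:
  assumes x: "x \<in> U"
  shows "lie_ten V H x $ i $ j = (\<Sum>q\<in>UNIV. V x $ q * D2 (\<lambda>i k y. H y $ i $ k) q i j x)
    + (\<Sum>q\<in>UNIV. H x $ q $ j * M1 (\<lambda>p y. V y $ p) i q x)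
    + (\<Sum>q\<in>UNIV. H x $ i $ q * M1 (\<lambda>p y. V y $ p) j q x)"
proof -
  have "(\<Sum>q\<in>UNIV. V x $ q * (\<Sum>m\<in>UNIV. \<Gamma> m q a x * c m)) = (\<Sum>q\<in>UNIV. c q * (\<Sum>m\<in>UNIV. \<Gamma> q a m x * V x $ m))" for c a
    unfolding sum_distrib_left by (subst sum.swap) (simp add: mult_ac \<Gamma>_sym[OF x, of _ a])
  from this[of i "\<lambda>m. H x $ m $ j"] this[of j "\<lambda>m. H x $ i $ m"]
  show ?thesis
    by (simp add: lie_ten_def D2_def D1_def M1_def right_diff_distrib distrib_left sum.distrib sum_subtractf)
qed

text \<open>Since the metric is parallel, only the derivatives of the vector field survive: the result is
  twice the symmetric part of the derivative of the lowered field.\<close>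

lemma lie_ten_metric:
  assumes x: "x \<in> U" and V: "smooth_on U V"
  shows "lie_ten V G x $ i $ k = D1 (\<lambda>k y. \<Sum>p\<in>UNIV. g k p y * V y $ p) i k x
    + D1 (\<lambda>k y. \<Sum>p\<in>UNIV. g k p y * V y $ p) k i x"
  by (simp add: lie_ten_eq[OF x] D2_g[OF x] D1_lower[OF x smooth_on_nth[OF open_U V]] g_sym[OF x, of _ k])

lemma lichnerowicz_eq:
  assumes x: "x \<in> U"
  shows "lichnerowicz G H x $ i $ k = (\<Sum>m\<in>UNIV. \<Sum>l\<in>UNIV. gi m l x * D3 (D2 (\<lambda>i k y. H y $ i $ k)) m l i k x)
    + 2 * (\<Sum>m\<in>UNIV. \<Sum>l\<in>UNIV. gi m l x * (\<Sum>p\<in>UNIV. Rup l i k p x * H x $ m $ p))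
    - (\<Sum>q\<in>UNIV. H x $ k $ q * (\<Sum>p\<in>UNIV. gi q p x * Ric i p x))
    - (\<Sum>q\<in>UNIV. H x $ i $ q * (\<Sum>p\<in>UNIV. gi q p x * Ric k p x))"
proof -
  have up: "(\<Sum>l\<in>UNIV. riemann G i j k l x * gi l q x) = Rup j i k q x" for j q
  proof -
    have "riemann G i j k l x = (\<Sum>s\<in>UNIV. g l s x * Rup j i k s x)" for l
      using Rlow_antisym_34[OF x, of i j l k] Rlow_antisym_12[of i j k l x]
      by (simp add: riemann_def Rlow_def)
    then show ?thesis
      using raise_lower[OF x, of q "\<lambda>s. Rup j i k s x"] by (simp add: mult.commute gi_sym[OF x, of _ q])
  qed
  have "(\<Sum>j\<in>UNIV. \<Sum>l\<in>UNIV. riemann G i j k l x * (\<Sum>p\<in>UNIV. \<Sum>q\<in>UNIV. gi j p x * gi l q x * H x $ p $ q))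
      = (\<Sum>j\<in>UNIV. \<Sum>p\<in>UNIV. gi j p x * (\<Sum>q\<in>UNIV. Rup j i k q x * H x $ p $ q))"
  proof (rule sum.cong[OF refl])
    fix j
    have "(\<Sum>l\<in>UNIV. riemann G i j k l x * (\<Sum>p\<in>UNIV. \<Sum>q\<in>UNIV. gi j p x * gi l q x * H x $ p $ q))
        = (\<Sum>p\<in>UNIV. \<Sum>l\<in>UNIV. \<Sum>q\<in>UNIV. riemann G i j k l x * (gi j p x * gi l q x * H x $ p $ q))"
      unfolding sum_distrib_left by (rule sum.swap)
    also have "\<dots> = (\<Sum>p\<in>UNIV. \<Sum>q\<in>UNIV. \<Sum>l\<in>UNIV. riemann G i j k l x * (gi j p x * gi l q x * H x $ p $ q))"
      by (rule sum.cong[OF refl sum.swap])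
    also have "\<dots> = (\<Sum>p\<in>UNIV. \<Sum>q\<in>UNIV. gi j p x * ((\<Sum>l\<in>UNIV. riemann G i j k l x * gi l q x) * H x $ p $ q))"
      by (simp add: sum_distrib_left sum_distrib_right mult_ac)
    finally show "(\<Sum>l\<in>UNIV. riemann G i j k l x * (\<Sum>p\<in>UNIV. \<Sum>q\<in>UNIV. gi j p x * gi l q x * H x $ p $ q))
        = (\<Sum>p\<in>UNIV. gi j p x * (\<Sum>q\<in>UNIV. Rup j i k q x * H x $ p $ q))"
      by (simp add: up sum_distrib_left)
  qed
  also have "\<dots> = (\<Sum>m\<in>UNIV. \<Sum>l\<in>UNIV. gi m l x * (\<Sum>p\<in>UNIV. Rup l i k p x * H x $ m $ p))"
    by (subst sum.swap) (simp only: gi_sym[OF x])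
  finally show ?thesis
    by (simp add: lichnerowicz_def laplacian_ten_def cov2_ten_eq ricci_eq[OF x] mult.commute)
qed

text \<open>Pair symmetry makes the curvature operator on tensors of rank two commute with transposition.
  This carries the equation of \<open>B = D w\<close> over to the transpose of \<open>B\<close>.\<close>

lemma curvature_term_flip:
  assumes x: "x \<in> U"
  shows "(\<Sum>m\<in>UNIV. \<Sum>l\<in>UNIV. gi m l x * (\<Sum>p\<in>UNIV. Rup l i k p x * B p m))
    = (\<Sum>m\<in>UNIV. \<Sum>l\<in>UNIV. gi m l x * (\<Sum>p\<in>UNIV. Rup l k i p x * B m p))"
proof -
  have raise: "Rup l a b p x = (\<Sum>q\<in>UNIV. gi p q x * Rlow l a b q x)" for l a b p
    using raise_lower[OF x, of p "\<lambda>p. Rup l a b p x"] by (simp add: Rlow_def)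
  have sym: "Rlow l i k q x = Rlow q k i l x" for l q
    using Rlow_pair[OF x, of l i k q] Rlow_antisym_12[of k q l i x] Rlow_antisym_34[OF x, of q k l i] by simp
  define S where "S = (\<lambda>m l p q. gi m l x * (gi p q x * (Rlow l i k q x * B p m)))"
  have "(\<Sum>m\<in>UNIV. \<Sum>l\<in>UNIV. gi m l x * (\<Sum>p\<in>UNIV. Rup l i k p x * B p m))
      = (\<Sum>m\<in>UNIV. \<Sum>l\<in>UNIV. \<Sum>p\<in>UNIV. \<Sum>q\<in>UNIV. S m l p q)"
    unfolding raise by (simp add: S_def sum_distrib_left sum_distrib_right mult.assoc)
  also have "\<dots> = (\<Sum>m\<in>UNIV. \<Sum>p\<in>UNIV. \<Sum>l\<in>UNIV. \<Sum>q\<in>UNIV. S m l p q)"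
    by (rule sum.cong[OF refl sum.swap])
  also have "\<dots> = (\<Sum>p\<in>UNIV. \<Sum>m\<in>UNIV. \<Sum>l\<in>UNIV. \<Sum>q\<in>UNIV. S m l p q)"
    by (rule sum.swap)
  also have "\<dots> = (\<Sum>p\<in>UNIV. \<Sum>m\<in>UNIV. \<Sum>q\<in>UNIV. \<Sum>l\<in>UNIV. S m l p q)"
    by (intro sum.cong refl sum.swap)
  also have "\<dots> = (\<Sum>p\<in>UNIV. \<Sum>q\<in>UNIV. \<Sum>m\<in>UNIV. \<Sum>l\<in>UNIV. S m l p q)"
    by (rule sum.cong[OF refl sum.swap])
  also have "\<dots> = (\<Sum>p\<in>UNIV. \<Sum>q\<in>UNIV. gi p q x * (\<Sum>m\<in>UNIV. Rup q k i m x * B p m))"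
    unfolding raise by (simp add: S_def sym sum_distrib_left sum_distrib_right mult_ac)
  finally show ?thesis .
qed

lemma D1_minus:
  assumes x: "x \<in> U" and T: "\<And>k. sm (T k)"
  shows "D1 (\<lambda>k y. - T k y) l k x = - D1 T l k x"
  by (simp add: D1_def pd_minus[OF x T] sum_negf)

lemma D2_sym_part:
  assumes x: "x \<in> U" and T: "\<And>i k. sm (T i k)"
  shows "D2 (\<lambda>i k y. T i k y + T k i y) l i k x = D2 T l i k x + D2 T l k i x"
  using T by (simp add: D2_def D1_def pd_rules x distrib_left sum.distrib)

lemma D3_sym_part:
  assumes x: "x \<in> U" and T: "\<And>l i k. sm (T l i k)"
  shows "D3 (\<lambda>l i k y. T l i k y + T l k i y) m l i k x = D3 T m l i k x + D3 T m l k i x"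
  using T by (simp add: D3_def D2_def D1_def pd_rules x distrib_left sum.distrib)

section \<open>Steady gradient solitons\<close>

text \<open>The core of the argument: \<open>B = D w\<close> satisfies the equation before symmetrisation.
  Differentiating the equation of \<open>W\<close> turns \<open>D \<Delta>w\<close> into \<open>- D(D\<^sub>X w)\<close>, which yields
  \<open>- Ric(B)\<close>, the wanted \<open>- D\<^sub>X B\<close> and a curvature term in \<open>X\<close> and \<open>w\<close>. The Ricci term cancels the one of
  \<open>laplacian_commutation\<close> because \<open>D X = Ric\<close>. The curvature term cancels the divergence of curvature,
  because \<open>Ric = D\<^sup>2 F\<close> makes the antisymmetrised derivative of \<open>Ric\<close> a Ricci identity for \<open>dF\<close>.\<close>

lemma soliton_laplacian:
  fixes W :: "real^'n \<Rightarrow> real^'n" and F :: "real^'n \<Rightarrow> real"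
  defines "w \<equiv> \<lambda>k y. \<Sum>p\<in>UNIV. g k p y * W y $ p"
  assumes W: "smooth_on U W" and F: "sm F"
    and soliton: "\<And>x. x \<in> U \<Longrightarrow> ricci G x = hessian G F x"
    and eq: "\<And>x. x \<in> U \<Longrightarrow> laplacian_vec G W x + cov_along G (gradient G F) W x = 0"
    and x: "x \<in> U"
  shows "(\<Sum>m\<in>UNIV. \<Sum>l\<in>UNIV. gi m l x * D3 (D2 (D1 w)) m l i k x)
    + (\<Sum>q\<in>UNIV. gradient G F x $ q * D2 (D1 w) q i k x)
    + 2 * (\<Sum>m\<in>UNIV. \<Sum>l\<in>UNIV. gi m l x * (\<Sum>p\<in>UNIV. Rup l i k p x * D1 w m p x)) = 0"
    and "M1 (\<lambda>p y. gradient G F y $ p) i p x = (\<Sum>q\<in>UNIV. gi p q x * Ric i q x)"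
proof -
  let ?B = "D1 w" and ?C = "D2 (D1 w)" and ?X = "\<lambda>p y. gradient G F y $ p"
  have smW: "sm (\<lambda>y. W y $ p)" for p by (rule smooth_on_nth[OF open_U W])
  have w: "sm (w k)" for k unfolding w_def by (intro sm_intros sm_g smW)
  have B: "sm (?B a b)" for a b by (intro sm_D1 w)
  have C: "sm (?C a b c)" for a b c by (intro sm_D2 B)
  have X: "sm (?X p)" for p unfolding gradient_def by (simp, intro sm_intros sm_gi F)
  have lowX: "(\<Sum>p\<in>UNIV. g s p y * ?X p y) = pd s F y" if "y \<in> U" for s y
    using lower_raise[OF that, of s "\<lambda>q. pd q F y"] by (simp add: gradient_def)
  have dF: "sm (pd k F)" for k by (intro sm_intros F)
  have RicF: "Ric i k y = D1 (\<lambda>k. pd k F) i k y" if "y \<in> U" for i k y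
    using ricci_eq[OF that] hessian_eq soliton[OF that] by metis
  have "(\<Sum>p\<in>UNIV. g s p x * M1 ?X i p x) = Ric i s x" for i s
  proof -
    have "(\<Sum>p\<in>UNIV. g s p x * M1 ?X i p x) = D1 (\<lambda>k y. \<Sum>p\<in>UNIV. g k p y * ?X p y) i s x"
      by (rule D1_lower[OF x X, symmetric])
    also have "\<dots> = D1 (\<lambda>k. pd k F) i s x"
      by (rule D1_cong[OF x]) (use lowX in \<open>auto intro!: sm_intros sm_g X\<close>)
    finally show ?thesis by (simp add: RicF[OF x])
  qed
  then show DX: "M1 ?X i p x = (\<Sum>q\<in>UNIV. gi p q x * Ric i q x)" for i p
    using raise_lower[OF x, of p "\<lambda>p. M1 ?X i p x"] by simp
  \<comment> \<open>The equation of \<open>W\<close> in lowered form, and its covariant derivative \<open>D_lap\<close>.\<close>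
  have B_low: "?B m p y = (\<Sum>q\<in>UNIV. g p q y * M1 (\<lambda>p y. W y $ p) m q y)" if "y \<in> U" for m p y
    unfolding w_def by (rule D1_lower[OF that smW])
  have C_low: "?C m l k y = (\<Sum>q\<in>UNIV. g k q y * M2 (M1 (\<lambda>p y. W y $ p)) m l q y)" if y: "y \<in> U" for m l k y
  proof -
    have "?C m l k y = D2 (\<lambda>l k y. \<Sum>q\<in>UNIV. g k q y * M1 (\<lambda>p y. W y $ p) l q y) m l k y"
      by (rule D2_cong[OF y B B_low])
    also have "\<dots> = (\<Sum>q\<in>UNIV. g k q y * M2 (M1 (\<lambda>p y. W y $ p)) m l q y)"
      by (rule D2_lower[OF y sm_M1[OF smW]])
    finally show ?thesis .
  qed
  have lap: "(\<Sum>m\<in>UNIV. \<Sum>l\<in>UNIV. gi m l y * ?C m l k y) = - (\<Sum>q\<in>UNIV. ?X q y * ?B q k y)" if y: "y \<in> U" for k y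
  proof -
    have "(\<Sum>m\<in>UNIV. \<Sum>l\<in>UNIV. gi m l y * ?C m l k y) = (\<Sum>p\<in>UNIV. g k p y * laplacian_vec G W y $ p)"
      using sum_pull[of "\<lambda>m l. gi m l y" "\<lambda>m l q. M2 (M1 (\<lambda>p y. W y $ p)) m l q y" "\<lambda>q. g k q y"]
      by (simp add: C_low[OF y] laplacian_vec_def cov2_vec_eq mult.commute)
    moreover have "(\<Sum>q\<in>UNIV. ?X q y * ?B q k y) = (\<Sum>p\<in>UNIV. g k p y * cov_along G (gradient G F) W y $ p)"
      using sum_peel[of "\<lambda>q. ?X q y" "\<lambda>p. g k p y" "\<lambda>q p. M1 (\<lambda>p y. W y $ p) q p y"]
      by (simp add: B_low[OF y] cov_along_def cov_vec_eq)
    moreover have "laplacian_vec G W y $ p = - cov_along G (gradient G F) W y $ p" for p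
      using eq[OF y] by (metis eq_neg_iff_add_eq_0 vector_uminus_component)
    ultimately show ?thesis by (simp add: sum_negf)
  qed
  have flip: "D2 (\<lambda>k q. ?B q k) i k q x = ?C i q k x" for i k q
    by (simp add: D2_def D1_def)
  have "D1 (\<lambda>k y. \<Sum>m\<in>UNIV. \<Sum>l\<in>UNIV. gi m l y * ?C m l k y) i k x = D1 (\<lambda>k y. - (\<Sum>q\<in>UNIV. ?X q y * ?B q k y)) i k x"
    by (rule D1_cong[OF x _ lap]) (intro sm_intros sm_gi C)
  also have "\<dots> = - D1 (\<lambda>k y. \<Sum>q\<in>UNIV. ?X q y * ?B q k y) i k x"
    by (rule D1_minus[OF x]) (intro sm_intros X B)
  also have "\<dots> = - (\<Sum>q\<in>UNIV. M1 ?X i q x * ?B q k x) - (\<Sum>q\<in>UNIV. ?X q x * ?C i q k x)"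
    using D1_contract[where V="?X" and T="\<lambda>k q. ?B q k", OF x X B, of i k] by (simp add: flip)
  finally have D_lap: "D1 (\<lambda>k y. \<Sum>m\<in>UNIV. \<Sum>l\<in>UNIV. gi m l y * ?C m l k y) i k x
    = - (\<Sum>q\<in>UNIV. M1 ?X i q x * ?B q k x) - (\<Sum>q\<in>UNIV. ?X q x * ?C i q k x)" .
  \<comment> \<open>The two curvature terms in \<open>X\<close> and \<open>W\<close>: one from exchanging the derivatives in \<open>XC\<close>, one from the
      divergence of curvature. They are equal by pair symmetry and enter with opposite signs.\<close>
  have low_pair: "(\<Sum>p\<in>UNIV. Rup a b c p x * (\<Sum>q\<in>UNIV. g p q x * V q)) = (\<Sum>q\<in>UNIV. V q * Rlow a b c q x)" for a b c V
    unfolding Rlow_def sum_distrib_left by (subst sum.swap) (simp add: mult_ac g_sym[OF x])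
  have "?C i q k x = ?C q i k x - (\<Sum>s\<in>UNIV. W x $ s * Rlow i q k s x)" for q
    using ricci_identity_1[where w=w, OF x w, of i q k] low_pair[of i q k "\<lambda>s. W x $ s"] by (simp add: w_def)
  then have XC: "(\<Sum>q\<in>UNIV. ?X q x * ?C i q k x) = (\<Sum>q\<in>UNIV. ?X q x * ?C q i k x)
      - (\<Sum>q\<in>UNIV. ?X q x * (\<Sum>s\<in>UNIV. W x $ s * Rlow i q k s x))"
    by (simp add: right_diff_distrib sum_subtractf)
  have "D2 Ric k q i x - D2 Ric q k i x = - (\<Sum>s\<in>UNIV. ?X s x * Rlow k q i s x)" for q
  proof -
    have R: "D2 Ric a b c x = D2 (D1 (\<lambda>k. pd k F)) a b c x" for a b c
      by (rule D2_cong[OF x sm_Ric RicF])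
    have "(\<Sum>p\<in>UNIV. Rup k q i p x * pd p F x) = (\<Sum>s\<in>UNIV. ?X s x * Rlow k q i s x)"
      using low_pair[of k q i "\<lambda>s. ?X s x"] by (simp only: lowX[OF x])
    then show ?thesis
      using ricci_identity_1[where w="\<lambda>k. pd k F", OF x dF, of k q i] by (simp add: R)
  qed
  then have "(\<Sum>q\<in>UNIV. (D2 Ric k q i x - D2 Ric q k i x) * W x $ q)
      = - (\<Sum>q\<in>UNIV. \<Sum>s\<in>UNIV. ?X s x * (W x $ q * Rlow k q i s x))"
    by (simp add: sum_negf sum_distrib_left mult_ac)
  also have "\<dots> = - (\<Sum>s\<in>UNIV. \<Sum>q\<in>UNIV. ?X s x * (W x $ q * Rlow i s k q x))"
    by (subst sum.swap) (simp add: Rlow_pair[OF x, of i _ k])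
  finally have div: "(\<Sum>q\<in>UNIV. (D2 Ric k q i x - D2 Ric q k i x) * W x $ q)
      = - (\<Sum>q\<in>UNIV. ?X q x * (\<Sum>s\<in>UNIV. W x $ s * Rlow i q k s x))"
    by (simp add: sum_distrib_left)
  show "(\<Sum>m\<in>UNIV. \<Sum>l\<in>UNIV. gi m l x * D3 ?C m l i k x)
    + (\<Sum>q\<in>UNIV. gradient G F x $ q * ?C q i k x)
    + 2 * (\<Sum>m\<in>UNIV. \<Sum>l\<in>UNIV. gi m l x * (\<Sum>p\<in>UNIV. Rup l i k p x * ?B m p x)) = 0"
    using laplacian_commutation[where w=w and V="\<lambda>q. W x $ q" and i=i and k=k, OF x w] D_lap XC div
    by (simp add: w_def DX)
qed

text \<open>The Lie derivative of the metric is \<open>B\<close> plus its transpose, and \<open>soliton_laplacian\<close> holds for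
  both. The Ricci terms of the Lichnerowicz Laplacian cancel against the derivatives of \<open>X\<close> in
  the Lie derivative along \<open>X\<close>, again because \<open>D X = Ric\<close>.\<close>

theorem lichnerowicz_lie_derivative:
  fixes W :: "real^'n \<Rightarrow> real^'n" and F :: "real^'n \<Rightarrow> real"
  assumes W: "smooth_on U W" and F: "sm F"
    and soliton: "\<And>x. x \<in> U \<Longrightarrow> ricci G x = hessian G F x"
    and eq: "\<And>x. x \<in> U \<Longrightarrow> laplacian_vec G W x + cov_along G (gradient G F) W x = 0"
    and x: "x \<in> U"
  shows "lichnerowicz G (lie_ten W G) x + lie_ten (gradient G F) (lie_ten W G) x = 0"
proof -
  define w where "w = (\<lambda>k y. \<Sum>p\<in>UNIV. g k p y * W y $ p)"
  let ?B = "D1 w" and ?C = "D2 (D1 w)"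
  have smW: "sm (\<lambda>y. W y $ p)" for p by (rule smooth_on_nth[OF open_U W])
  have w: "sm (w k)" for k unfolding w_def by (intro sm_intros sm_g smW)
  have B: "sm (?B a b)" for a b by (intro sm_D1 w)
  have C: "sm (?C a b c)" for a b c by (intro sm_D2 B)
  let ?h = "\<lambda>i k y. lie_ten W G y $ i $ k"
  have h: "?h i k y = ?B i k y + ?B k i y" if "y \<in> U" for i k y
    using lie_ten_metric[OF that W] by (simp add: w_def)
  have sh: "sm (\<lambda>y. ?B i k y + ?B k i y)" for i k by (intro sm_intros B)
  have D2h: "D2 ?h l i k y = ?C l i k y + ?C l k i y" if "y \<in> U" for l i k y
    using D2_cong[where T="\<lambda>i k y. ?B i k y + ?B k i y" and T'="?h", OF that sh h[symmetric]]
      D2_sym_part[where T="?B", OF that B] by simp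
  have sC: "sm (\<lambda>y. ?C l i k y + ?C l k i y)" for l i k by (intro sm_intros C)
  have D3h: "D3 (D2 ?h) m l i k x = D3 ?C m l i k x + D3 ?C m l k i x" for m l i k
    using D3_cong[where T="\<lambda>l i k y. ?C l i k y + ?C l k i y" and T'="D2 ?h", OF x sC D2h[symmetric]]
      D3_sym_part[where T="?C", OF x C] by simp
  have "(lichnerowicz G (lie_ten W G) x + lie_ten (gradient G F) (lie_ten W G) x) $ i $ k = 0" for i k
  proof -
    note S = soliton_laplacian[OF W F soliton eq x, folded w_def]
    have "(\<Sum>m\<in>UNIV. \<Sum>l\<in>UNIV. gi m l x * (\<Sum>p\<in>UNIV. Rup l i k p x * ?h m p x))
        = (\<Sum>m\<in>UNIV. \<Sum>l\<in>UNIV. gi m l x * (\<Sum>p\<in>UNIV. Rup l i k p x * ?B m p x))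
        + (\<Sum>m\<in>UNIV. \<Sum>l\<in>UNIV. gi m l x * (\<Sum>p\<in>UNIV. Rup l k i p x * ?B m p x))"
      using curvature_term_flip[OF x, of i k "\<lambda>p m. ?B p m x"]
      by (simp add: h[OF x] distrib_left sum.distrib)
    moreover have "(\<Sum>m\<in>UNIV. \<Sum>l\<in>UNIV. gi m l x * D3 (D2 ?h) m l i k x)
        = (\<Sum>m\<in>UNIV. \<Sum>l\<in>UNIV. gi m l x * D3 ?C m l i k x) + (\<Sum>m\<in>UNIV. \<Sum>l\<in>UNIV. gi m l x * D3 ?C m l k i x)"
      by (simp add: D3h distrib_left sum.distrib)
    moreover have "(\<Sum>q\<in>UNIV. gradient G F x $ q * D2 ?h q i k x)
        = (\<Sum>q\<in>UNIV. gradient G F x $ q * ?C q i k x) + (\<Sum>q\<in>UNIV. gradient G F x $ q * ?C q k i x)"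
      by (simp add: D2h[OF x] distrib_left sum.distrib)
    moreover have "?h q k x = ?h k q x" for q by (simp add: h[OF x])
    ultimately show ?thesis
      using S(1)[of i k] S(1)[of k i]
      by (simp add: lichnerowicz_eq[OF x] lie_ten_eq[OF x] S(2))
  qed
  then show ?thesis by (simp add: vec_eq_iff)
qed

end

theorem theorem4p1:
  fixes A :: "('a::{t2_space,second_countable_topology}, 3) chart set"
    and g :: "('a, 3) tfield" and f :: "'a \<Rightarrow> real" and W X :: "('a, 3) vfield" and \<kappa> :: real
  assumes "connected_smooth_manifold A"
    and "riemannian_metric A g"
    and "riem_complete A g"
    and "\<not> flat A g"
    and "noncollapsed \<kappa> A g"
    and "steady_gradient_soliton A g f"
    and "X = grad_field g f"
    and "smooth_vector_field A W"
    and "\<forall>c\<in>A. \<forall>x\<in>coords c. laplacian_vec (g c) (W c) x + cov_along (g c) (X c) (W c) x = 0"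
  shows "\<forall>c\<in>A. \<forall>x\<in>coords c.
    lichnerowicz (g c) (lie_field W g c) x + lie_ten (X c) (lie_field W g c) x = 0"
proof (intro ballI)
  fix c x
  assume c: "c \<in> A" and x: "x \<in> coords c"
  interpret local_metric "coords c" "g c"
    using assms(1,2) c
    by unfold_locales
      (auto simp: connected_smooth_manifold_def riemannian_metric_def smooth_cov2_tensor_def)
  have X: "X c = gradient (g c) (in_chart f c)"
    using assms(7) by (simp add: grad_field_def)
  show "lichnerowicz (g c) (lie_field W g c) x + lie_ten (X c) (lie_field W g c) x = 0"
    unfolding X lie_field_def
  proof (rule lichnerowicz_lie_derivative[OF _ _ _ _ x])
    show "smooth_on (coords c) (W c)"
      using assms(8) c by (auto simp: smooth_vector_field_def)
    show "smooth_on (coords c) (in_chart f c)"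
      using assms(6) c by (auto simp: steady_gradient_soliton_def smooth_function_def)
    show "ricci (g c) y = hessian (g c) (in_chart f c) y" if "y \<in> coords c" for y
      using assms(6) c that by (auto simp: steady_gradient_soliton_def)
    show "laplacian_vec (g c) (W c) y + cov_along (g c) (gradient (g c) (in_chart f c)) (W c) y = 0"
      if "y \<in> coords c" for y
      using assms(9) c that X by auto
  qed
qed

end
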